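(* Let $(X(t),\alpha(t))$ be the regime-switching jump diffusion described in the context, and assume (A1)–(A3). Let $p>0$. If the equilibrium point $x=0$ is exponentially $p$-stable, i.e. there are positive constants $K,k$ with $E|X^{x,\alpha}(t)|^p\le K|x|^pe^{-kt}$ for all $t\ge 0$ and all $(x,\alpha)\in\mathbb R^r\times\mathcal M$, then it is almost surely exponentially stable, i.e. for every $(x,\alpha)\in\mathbb R^r\times\mathcal M$, $$\limsup_{t\to\infty}\frac1t\ln|X^{x,\alpha}(t)|<0\quad\text{with probability }1.$$
   Context: Setting. $\mathcal M=\{1,\dots,m\}$, $\Gamma\subset\mathbb R^r\setminus\{0\}$. The functions $b:\mathbb R^r\times\mathcal M\to\mathbb R^r$, $\sigma:\mathbb R^r\times\mathcal M\to\mathbb R^{r\times d}$, $g:\mathbb R^r\times\mathcal M\times\Gamma\to\mathbb R^r$ are given. $w$ is a $d$-dimensional standard Brownian motion; $N(dt,d\gamma)$ is a Poisson random measure on $[0,\infty)\times\Gamma$ with intensity $\lambda\,dt\,\pi(d\gamma)$, where $0<\lambda<\infty$ and $\pi$ is a probability measure on $\Gamma$; $w$ and $N$ are independent. The two-component Markov process $(X(t),\alpha(t))\in\mathbb R^r\times\mathcal M$ satisfies $$X(t)=x+\int_0^t b(X(s),\alpha(s))ds+\int_0^t\sigma(X(s),\alpha(s))dw(s)+\int_0^t\int_\Gamma g(X(s^-),\alpha(s^-),\gamma)N(ds,d\gamma),\quad \alpha(0)=\alpha,$$ with $P\{\alpha(t+\Delta t)=j\mid\alpha(t)=i,X(s),\alpha(s),s\le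 t\}=q_{ij}(X(t))\Delta t+o(\Delta t)$ for $i\ne j$. The matrix $Q(x)=(q_{ij}(x))$ has Borel measurable, uniformly bounded entries, $q_{ij}(x)\ge0$ for $i\ne j$, and $q_{ii}(x)=-\sum_{j\ne i}q_{ij}(x)$. The process with initial data $(x,\alpha)$ is written $(X^{x,\alpha},\alpha^{x,\alpha})$. Convention: $\ln 0=-\infty$. Assumptions. (A1) $b(0,i)=0$, $\sigma(0,i)=0$, $g(0,i,\gamma)=0$ for all $i\in\mathcal M$, $\gamma\in\Gamma$; $\sigma(x,i)$ vanishes only at $x=0$. (A2) There is $K_0>0$ with $|b(x,i)-b(y,i)|+|\sigma(x,i)-\sigma(y,i)|\le K_0|x-y|$ and $|g(x,i,\gamma)-g(y,i,\gamma)|\le K_0|x-y|$ for all $x,y\in\mathbb R^r$, $i\in\mathcal M$, $\gamma\in\Gamma$. (A3) There are constants $g^*(i)$ with $|g(x,i,\gamma)|\le g^*(i)|x|$ for all $x,i,\gamma$. Matrix norm: $|A|=\sqrt{\mathrm{tr}(AA')}$ ($'$ is transpose). *)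

theory Defs
  imports "HOL-Probability.Probability"
begin

section \<open>Probabilistic preliminaries\<close>

definition generated_sigma ::
    "'a set \<Rightarrow> 'i set \<Rightarrow> 'b measure \<Rightarrow> ('i \<Rightarrow> 'a \<Rightarrow> 'b) \<Rightarrow> 'a measure" where
  "generated_sigma \<Omega> I S Y = sigma \<Omega> {Y i -` B \<inter> \<Omega> | i B. i \<in> I \<and> B \<in> sets S}"

text \<open>Convergence to \<open>0\<close> in probability of a family of \<open>[0,\<infinity>]\<close>-valued random variables.\<close>

definition vanishes_in_probability ::
    "'a measure \<Rightarrow> ('i \<Rightarrow> 'a \<Rightarrow> ennreal) \<Rightarrow> 'i filter \<Rightarrow> bool" where
  "vanishes_in_probability M Y G \<longleftrightarrow>
     (\<forall>\<epsilon>>0. ((\<lambda>n. measure M {\<omega> \<in> space M. ennreal \<epsilon> < Y n \<omega>}) \<longlongrightarrow> (0::real)) G)"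

definition brownian_motion ::
    "'a measure \<Rightarrow> (real \<Rightarrow> 'a measure) \<Rightarrow> (real \<Rightarrow> 'a \<Rightarrow> real^'d::finite) \<Rightarrow> bool" where
  "brownian_motion M F w \<longleftrightarrow>
     (AE \<omega> in M. w 0 \<omega> = 0) \<and>
     (\<forall>\<omega>\<in>space M. continuous_on {0..} (\<lambda>t. w t \<omega>)) \<and>
     (\<forall>t\<ge>0. w t \<in> borel_measurable (F t)) \<and>
     (\<forall>s t. 0 \<le> s \<longrightarrow> s < t \<longrightarrow>
        prob_space.indep_set M (sets (F s))
          {(\<lambda>\<omega>. w t \<omega> - w s \<omega>) -` B \<inter> space M | B. B \<in> sets borel} \<and>
        prob_space.indep_vars M (\<lambda>_. borel) (\<lambda>j \<omega>. (w t \<omega> - w s \<omega>) $ j) UNIV \<and>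
        (\<forall>j. distributed M lborel (\<lambda>\<omega>. (w t \<omega> - w s \<omega>) $ j)
               (\<lambda>y. ennreal (normal_density 0 (sqrt (t - s)) y))))"

definition poisson_random_measure ::
    "'a measure \<Rightarrow> 'e measure \<Rightarrow> ('a \<Rightarrow> 'e measure) \<Rightarrow> bool" where
  "poisson_random_measure M \<mu> N \<longleftrightarrow>
     (\<forall>\<omega>\<in>space M. sets (N \<omega>) = sets \<mu>) \<and>
     (\<forall>A\<in>sets \<mu>. (\<lambda>\<omega>. emeasure (N \<omega>) A) \<in> borel_measurable M) \<and>
     (\<forall>A\<in>sets \<mu>. emeasure \<mu> A < \<infinity> \<longrightarrow>
        (\<forall>n::nat. measure M {\<omega>\<in>space M. emeasure (N \<omega>) A = of_nat n}
                  = exp (- measure \<mu> A) * measure \<mu> A ^ n / fact n)) \<and>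
     (\<forall>A\<in>sets \<mu>. emeasure \<mu> A = \<infinity> \<longrightarrow> (AE \<omega> in M. emeasure (N \<omega>) A = \<infinity>)) \<and>
     (\<forall>(I::nat set) A. A ` I \<subseteq> sets \<mu> \<longrightarrow> disjoint_family_on A I \<longrightarrow>
        prob_space.indep_vars M (\<lambda>_. borel) (\<lambda>i \<omega>. emeasure (N \<omega>) (A i)) I)"

section \<open>The Ito integral\<close>

definition progressively_measurable ::
    "(real \<Rightarrow> 'a measure) \<Rightarrow> (real \<Rightarrow> 'a \<Rightarrow> 'b::topological_space) \<Rightarrow> bool" where
  "progressively_measurable F H \<longleftrightarrow>
     (\<forall>T\<ge>0. (\<lambda>(t, \<omega>). H t \<omega>) \<in> borel_measurable (restrict_space borel {0..T} \<Otimes>\<^sub>M F T))"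

text \<open>
  The data \<open>(k, \<tau>, \<xi>)\<close> encode the simple process
  \<open>\<Sum>i<k. \<xi> i * indicator {\<tau> i <.. \<tau> (i+1)}\<close>, where \<open>\<xi> i\<close> is bounded and \<open>F (\<tau> i)\<close>-measurable.
\<close>

definition simple_data ::
    "'a measure \<Rightarrow> (real \<Rightarrow> 'a measure) \<Rightarrow> nat \<Rightarrow> (nat \<Rightarrow> real)
      \<Rightarrow> (nat \<Rightarrow> 'a \<Rightarrow> 'b::real_normed_vector) \<Rightarrow> bool" where
  "simple_data M F k \<tau> \<xi> \<longleftrightarrow>
     0 \<le> \<tau> 0 \<and> (\<forall>i<k. \<tau> i \<le> \<tau> (Suc i)) \<and>
     (\<forall>i<k. \<xi> i \<in> borel_measurable (F (\<tau> i)) \<and> (\<exists>C. \<forall>\<omega>\<in>space M. norm (\<xi> i \<omega>) \<le> C))"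

definition simple_process ::
    "nat \<Rightarrow> (nat \<Rightarrow> real) \<Rightarrow> (nat \<Rightarrow> 'a \<Rightarrow> 'b::real_normed_vector) \<Rightarrow> real \<Rightarrow> 'a \<Rightarrow> 'b" where
  "simple_process k \<tau> \<xi> t \<omega> = (\<Sum>i<k. indicator {\<tau> i<..\<tau> (Suc i)} t *\<^sub>R \<xi> i \<omega>)"

definition simple_integral ::
    "(real \<Rightarrow> 'a \<Rightarrow> real^'d::finite) \<Rightarrow> nat \<Rightarrow> (nat \<Rightarrow> real)
      \<Rightarrow> (nat \<Rightarrow> 'a \<Rightarrow> real^'d^'r::finite) \<Rightarrow> real \<Rightarrow> 'a \<Rightarrow> real^'r" where
  "simple_integral w k \<tau> \<xi> t \<omega> =
     (\<Sum>i<k. \<xi> i \<omega> *v (w (min t (\<tau> (Suc i))) \<omega> - w (min t (\<tau> i)) \<omega>))"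

text \<open>
  \<open>J\<close> is (a continuous version of) the process \<open>\<integral>\<^sub>0\<^sup>t H dw\<close>: the limit in probability of the
  integrals of simple processes approximating \<open>H\<close> in \<open>L\<^sup>2([0,T])\<close>, in probability, for every \<open>T\<close>.
  This determines \<open>J\<close> up to indistinguishability. The norm on \<^typ>\<open>real^'d^'r\<close> is the
  Frobenius norm \<open>\<surd>tr(AA')\<close>.
\<close>

definition is_ito_integral ::
    "'a measure \<Rightarrow> (real \<Rightarrow> 'a measure) \<Rightarrow> (real \<Rightarrow> 'a \<Rightarrow> real^'d::finite)
      \<Rightarrow> (real \<Rightarrow> 'a \<Rightarrow> real^'d^'r::finite) \<Rightarrow> (real \<Rightarrow> 'a \<Rightarrow> real^'r) \<Rightarrow> bool" where
  "is_ito_integral M F w H J \<longleftrightarrow>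
     progressively_measurable F H \<and>
     (\<forall>T\<ge>0. AE \<omega> in M. (\<integral>\<^sup>+s\<in>{0..T}. ennreal ((norm (H s \<omega>))\<^sup>2) \<partial>lborel) < \<infinity>) \<and>
     (\<forall>t\<ge>0. J t \<in> borel_measurable M) \<and>
     (\<forall>\<omega>\<in>space M. continuous_on {0..} (\<lambda>t. J t \<omega>)) \<and>
     (\<exists>k \<tau> \<xi>. (\<forall>n. simple_data M F (k n) (\<tau> n) (\<xi> n)) \<and>
        (\<forall>T\<ge>0. vanishes_in_probability M
           (\<lambda>n \<omega>. \<integral>\<^sup>+s\<in>{0..T}.
              ennreal ((norm (simple_process (k n) (\<tau> n) (\<xi> n) s \<omega> - H s \<omega>))\<^sup>2) \<partial>lborel)
           sequentially) \<and>
        (\<forall>t\<ge>0. vanishes_in_probability M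
           (\<lambda>n \<omega>. ennreal (norm (simple_integral w (k n) (\<tau> n) (\<xi> n) t \<omega> - J t \<omega>)))
           sequentially))"

section \<open>Regime-switching jump diffusions\<close>

definition left_limit :: "(real \<Rightarrow> 'b::t2_space) \<Rightarrow> real \<Rightarrow> 'b" where
  "left_limit f t = Lim (at_left t) f"

definition cadlag :: "(real \<Rightarrow> 'b::t2_space) \<Rightarrow> bool" where
  "cadlag f \<longleftrightarrow> (\<forall>t\<ge>0. (f \<longlongrightarrow> f t) (at_right t)) \<and> (\<forall>t>0. \<exists>l. (f \<longlongrightarrow> l) (at_left t))"

text \<open>The filtration is indexed by all of \<^typ>\<open>real\<close>, but only its members at times \<open>t \<ge> 0\<close> matter.\<close>

locale driving_noise =
  prob_space M + filtration "space M" F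
  for M :: "'a measure" and F :: "real \<Rightarrow> 'a measure" +
  fixes w :: "real \<Rightarrow> 'a \<Rightarrow> real^'d::finite"
    and \<Gamma> :: "(real^'r::finite) set"
    and lam :: real
    and \<pi> :: "(real^'r) measure"
    and N :: "'a \<Rightarrow> (real \<times> (real^'r)) measure"
  assumes subalgebra_F: "subalgebra M (F t)"
    and Gamma_nonzero: "0 \<notin> \<Gamma>"
    and lam_pos: "0 < lam"
    and prob_space_jumps: "prob_space \<pi>"
    and sets_jumps: "sets \<pi> = sets (restrict_space borel \<Gamma>)"
    and brownian: "brownian_motion M F w"
    and poisson: "poisson_random_measure M
          (restrict_space lborel {0..} \<Otimes>\<^sub>M scale_measure (ennreal lam) \<pi>) N"
    and poisson_adapted: "\<And>t A. 0 \<le> t \<Longrightarrow> A \<in> sets (restrict_space lborel {0..} \<Otimes>\<^sub>M \<pi>) \<Longrightarrow>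
          A \<subseteq> {0..t} \<times> \<Gamma> \<Longrightarrow> (\<lambda>\<omega>. emeasure (N \<omega>) A) \<in> borel_measurable (F t)"
    and poisson_future_indep: "\<And>t. 0 \<le> t \<Longrightarrow>
          indep_set (sets (F t))
            (sets (generated_sigma (space M)
              {A \<in> sets (restrict_space lborel {0..} \<Otimes>\<^sub>M \<pi>). A \<subseteq> {t<..} \<times> \<Gamma>}
              borel (\<lambda>A \<omega>. emeasure (N \<omega>) A)))"
    and brownian_poisson_indep:
          "indep_set (sets (generated_sigma (space M) {0..} borel w))
            (sets (generated_sigma (space M) (sets (restrict_space lborel {0..} \<Otimes>\<^sub>M \<pi>))
              borel (\<lambda>A \<omega>. emeasure (N \<omega>) A)))"

text \<open>
  \<open>X\<close> and \<open>\<alpha>\<close> solve the stochastic equation for \<open>X\<close> with initial data \<open>(x, a)\<close>; all the integrals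
  occurring are required to exist. The integral with respect to \<open>N\<close> is a pathwise Lebesgue
  integral.
\<close>

definition (in driving_noise) solves_sde ::
    "(real^'r \<Rightarrow> nat \<Rightarrow> real^'r) \<Rightarrow> (real^'r \<Rightarrow> nat \<Rightarrow> real^'d^'r)
      \<Rightarrow> (real^'r \<Rightarrow> nat \<Rightarrow> real^'r \<Rightarrow> real^'r)
      \<Rightarrow> real^'r \<Rightarrow> nat \<Rightarrow> (real \<Rightarrow> 'a \<Rightarrow> real^'r) \<Rightarrow> (real \<Rightarrow> 'a \<Rightarrow> nat) \<Rightarrow> bool" where
  "solves_sde b \<sigma> g x a X \<alpha> \<longleftrightarrow>
     (AE \<omega> in M. \<alpha> 0 \<omega> = a) \<and>
     (\<exists>J. is_ito_integral M F w (\<lambda>s \<omega>. \<sigma> (X s \<omega>) (\<alpha> s \<omega>)) J \<and>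
       (AE \<omega> in M. \<forall>t\<ge>0.
          set_integrable lborel {0..t} (\<lambda>s. b (X s \<omega>) (\<alpha> s \<omega>)) \<and>
          set_integrable (N \<omega>) ({0<..t} \<times> \<Gamma>)
            (\<lambda>(s, \<gamma>). g (left_limit (\<lambda>u. X u \<omega>) s) (left_limit (\<lambda>u. \<alpha> u \<omega>) s) \<gamma>) \<and>
          X t \<omega> = x + (LINT s:{0..t}|lborel. b (X s \<omega>) (\<alpha> s \<omega>)) + J t \<omega>
            + (LINT (s, \<gamma>):{0<..t} \<times> \<Gamma>|N \<omega>.
                 g (left_limit (\<lambda>u. X u \<omega>) s) (left_limit (\<lambda>u. \<alpha> u \<omega>) s) \<gamma>)))"

definition history ::
    "'a measure \<Rightarrow> (real \<Rightarrow> 'a \<Rightarrow> 'b::topological_space) \<Rightarrow> (real \<Rightarrow> 'a \<Rightarrow> nat) \<Rightarrow> real \<Rightarrow> 'a measure" where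
  "history M X \<alpha> t = generated_sigma (space M) {0..t} (borel \<Otimes>\<^sub>M count_space UNIV)
     (\<lambda>s \<omega>. (X s \<omega>, \<alpha> s \<omega>))"

text \<open>
  \<open>P(\<alpha>(t+h) = j | \<alpha>(t) = i, X(s), \<alpha>(s), s \<le> t) = q\<^sub>i\<^sub>j(X(t)) h + o(h)\<close> as \<open>h \<down> 0\<close>. For each \<open>h\<close> the
  conditional probability is only determined up to a null set, so \<open>o(h)\<close> is read in probability;
  this is implied by the almost sure reading, whatever versions are chosen.
\<close>

definition switching_law ::
    "'a measure \<Rightarrow> nat \<Rightarrow> ('b::topological_space \<Rightarrow> nat \<Rightarrow> nat \<Rightarrow> real)
      \<Rightarrow> (real \<Rightarrow> 'a \<Rightarrow> 'b) \<Rightarrow> (real \<Rightarrow> 'a \<Rightarrow> nat) \<Rightarrow> bool" where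
  "switching_law M m q X \<alpha> \<longleftrightarrow>
     (\<forall>t\<ge>0. \<forall>i\<in>{1..m}. \<forall>j\<in>{1..m}. i \<noteq> j \<longrightarrow>
        vanishes_in_probability M
          (\<lambda>h \<omega>. if \<alpha> t \<omega> = i
             then ennreal (\<bar>real_cond_exp M (history M X \<alpha> t)
                     (indicator {\<omega>'\<in>space M. \<alpha> (t + h) \<omega>' = j}) \<omega> - q (X t \<omega>) i j * h\<bar> / h)
             else 0)
          (at_right 0))"

text \<open>
  The family \<open>(X x a, \<alpha> x a)\<close>, indexed by the initial data, is a time-homogeneous Markov process
  with transition function \<open>(t, (y, c), A) \<mapsto> P((X y c t, \<alpha> y c t) \<in> A)\<close>.
\<close>

definition markov_family ::
    "'a measure \<Rightarrow> nat \<Rightarrow> ('b::topological_space \<Rightarrow> nat \<Rightarrow> real \<Rightarrow> 'a \<Rightarrow> 'b)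
      \<Rightarrow> ('b \<Rightarrow> nat \<Rightarrow> real \<Rightarrow> 'a \<Rightarrow> nat) \<Rightarrow> bool" where
  "markov_family M m X \<alpha> \<longleftrightarrow>
     (\<forall>t\<ge>0. \<forall>A\<in>sets (borel \<Otimes>\<^sub>M count_space UNIV).
        (\<forall>c\<in>{1..m}. (\<lambda>y. measure M {\<omega>\<in>space M. (X y c t \<omega>, \<alpha> y c t \<omega>) \<in> A})
                       \<in> borel_measurable borel) \<and>
        (\<forall>x. \<forall>a\<in>{1..m}. \<forall>s\<ge>0. AE \<omega> in M.
           real_cond_exp M (history M (X x a) (\<alpha> x a) s)
             (indicator {\<omega>'\<in>space M. (X x a (s + t) \<omega>', \<alpha> x a (s + t) \<omega>') \<in> A}) \<omega> =
           measure M {\<omega>'\<in>space M. (X (X x a s \<omega>) (\<alpha> x a s \<omega>) t \<omega>',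
                                    \<alpha> (X x a s \<omega>) (\<alpha> x a s \<omega>) t \<omega>') \<in> A}))"

locale regime_switching_jump_diffusion =
  driving_noise M F w \<Gamma> lam \<pi> N
  for M :: "'a measure" and F :: "real \<Rightarrow> 'a measure"
    and w :: "real \<Rightarrow> 'a \<Rightarrow> real^'d::finite"
    and \<Gamma> :: "(real^'r::finite) set" and lam :: real and \<pi> :: "(real^'r) measure"
    and N :: "'a \<Rightarrow> (real \<times> (real^'r)) measure" +
  fixes m :: nat
    and b :: "real^'r \<Rightarrow> nat \<Rightarrow> real^'r"
    and \<sigma> :: "real^'r \<Rightarrow> nat \<Rightarrow> real^'d^'r"
    and g :: "real^'r \<Rightarrow> nat \<Rightarrow> real^'r \<Rightarrow> real^'r"
    and q :: "real^'r \<Rightarrow> nat \<Rightarrow> nat \<Rightarrow> real"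
    and X :: "real^'r \<Rightarrow> nat \<Rightarrow> real \<Rightarrow> 'a \<Rightarrow> real^'r"
    and \<alpha> :: "real^'r \<Rightarrow> nat \<Rightarrow> real \<Rightarrow> 'a \<Rightarrow> nat"
  assumes regimes: "1 \<le> m"
    and q_measurable:
      "\<And>i j. i \<in> {1..m} \<Longrightarrow> j \<in> {1..m} \<Longrightarrow> (\<lambda>x. q x i j) \<in> borel_measurable borel"
    and q_bounded: "\<exists>C. \<forall>x. \<forall>i\<in>{1..m}. \<forall>j\<in>{1..m}. \<bar>q x i j\<bar> \<le> C"
    and q_off_diagonal: "\<And>x i j. i \<in> {1..m} \<Longrightarrow> j \<in> {1..m} \<Longrightarrow> i \<noteq> j \<Longrightarrow> 0 \<le> q x i j"
    and q_diagonal: "\<And>x i. i \<in> {1..m} \<Longrightarrow> q x i i = - (\<Sum>j\<in>{1..m} - {i}. q x i j)"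
    and X_adapted:
      "\<And>x a t. a \<in> {1..m} \<Longrightarrow> 0 \<le> t \<Longrightarrow> X x a t \<in> borel_measurable (F t)"
    and alpha_adapted:
      "\<And>x a t. a \<in> {1..m} \<Longrightarrow> 0 \<le> t \<Longrightarrow> \<alpha> x a t \<in> F t \<rightarrow>\<^sub>M count_space UNIV"
    and alpha_range:
      "\<And>x a t \<omega>. a \<in> {1..m} \<Longrightarrow> 0 \<le> t \<Longrightarrow> \<omega> \<in> space M \<Longrightarrow> \<alpha> x a t \<omega> \<in> {1..m}"
    and X_cadlag: "\<And>x a \<omega>. a \<in> {1..m} \<Longrightarrow> \<omega> \<in> space M \<Longrightarrow> cadlag (\<lambda>t. X x a t \<omega>)"
    and alpha_cadlag: "\<And>x a \<omega>. a \<in> {1..m} \<Longrightarrow> \<omega> \<in> space M \<Longrightarrow> cadlag (\<lambda>t. \<alpha> x a t \<omega>)"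
    and sde: "\<And>x a. a \<in> {1..m} \<Longrightarrow> solves_sde b \<sigma> g x a (X x a) (\<alpha> x a)"
    and switching: "\<And>x a. a \<in> {1..m} \<Longrightarrow> switching_law M m q (X x a) (\<alpha> x a)"
    and markov: "markov_family M m X \<alpha>"

section \<open>Stability of the equilibrium\<close>

text \<open>
  The \<open>p\<close>-th moment is taken as an integral in \<open>[0,\<infinity>]\<close>, so that the estimate includes its
  finiteness.
\<close>

definition exponentially_p_stable ::
    "'a measure \<Rightarrow> nat \<Rightarrow> ('b::real_normed_vector \<Rightarrow> nat \<Rightarrow> real \<Rightarrow> 'a \<Rightarrow> 'b) \<Rightarrow> real \<Rightarrow> bool" where
  "exponentially_p_stable M m X p \<longleftrightarrow>
     (\<exists>K>0. \<exists>k>0. \<forall>t\<ge>0. \<forall>x. \<forall>a\<in>{1..m}.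
        (\<integral>\<^sup>+\<omega>. ennreal (norm (X x a t \<omega>) powr p) \<partial>M)
          \<le> ennreal (K * norm x powr p * exp (- k * t)))"

definition extended_ln :: "real \<Rightarrow> ereal" where
  "extended_ln y = (if y = 0 then - \<infinity> else ereal (ln y))"

definition almost_surely_exponentially_stable ::
    "'a measure \<Rightarrow> nat \<Rightarrow> ('b::real_normed_vector \<Rightarrow> nat \<Rightarrow> real \<Rightarrow> 'a \<Rightarrow> 'b) \<Rightarrow> bool" where
  "almost_surely_exponentially_stable M m X \<longleftrightarrow>
     (\<forall>x. \<forall>a\<in>{1..m}. AE \<omega> in M.
        Limsup at_top (\<lambda>t::real. ereal (1 / t) * extended_ln (norm (X x a t \<omega>))) < 0)"

end

(* The proof is an Ottaviani-type argument, which needs no moment bound on the supremum of the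
   process. A maximal inequality for the Ito integral, stopped when it or its bracket becomes large,
   shows that on a short time interval, with no jump of N, the process started from y leaves the ball
   of radius |y|/2 about y only with small probability; by homogeneity the length of the interval does
   not depend on y. Hence P(|X^y(s)| >= |y|/2) >= 1/2 for s <= delta, uniformly in y and the regime.
   By the Markov property at the first time of a grid at which |X| exceeds rho, the probability that
   sup |X| > rho over [n delta, (n+1) delta) is at most 2 P(|X((n+1) delta)| >= rho/2). The p-th
   moment bound with rho = exp(- k (n+1) delta / (2p)) makes these probabilities summable, and
   Borel-Cantelli concludes. *)

theory Submission
  imports Defs
begin

text \<open>The bound 1/2 is shared evenly: a jump on the short interval costs at most
  \<open>lam * \<delta>\<close> <= 1/4, the Ito integral at most 1/4. Jumps are excluded outright
  because \<open>g\<close> may carry the path into or next to 0. The scaling rests on linear growth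
  of \<open>b\<close> and \<open>\<sigma>\<close>, which follows from the Lipschitz condition and
  the vanishing at 0: until the exit from the ball, both are at most (3/2) K |y|, and |y| cancels
  from every estimate.

  The obstacle is that the Ito integral is given only as a limit in probability at each fixed time,
  while its integrand is controlled only up to a random exit time. The maximal inequality therefore
  concerns the events that, at one and the same time t, the integral is large and its bracket small.
  These events survive the passage to the limit for finitely many t, hence for all rational t, and a
  rational time just after the exit falls into one of them.

  The decay rate is also shared: with exponent k / (2p), the p-th power of the threshold uses up
  half of k in Markov's inequality, and the remaining half makes the series converge.\<close>

section \<open>Countable families of times; independence and moments of Brownian increments\<close>

text \<open>Continuity from below along an enumeration of \<open>D\<close>. The discrete arguments
  below handle finitely many times; this carries their bounds over to all rational times.\<close>

lemma (in finite_measure) measure_countable_UN_le: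
  assumes D: "countable D" and meas: "\<And>t. t \<in> D \<Longrightarrow> A t \<in> sets M"
    and le: "\<And>T. finite T \<Longrightarrow> T \<subseteq> D \<Longrightarrow> measure M (\<Union>t\<in>T. A t) \<le> C"
  shows "measure M (\<Union>t\<in>D. A t) \<le> C"
proof (cases "D = {}")
  case True
  then show ?thesis using le[of "{}"] by simp
next
  case False
  define e where "e = from_nat_into D"
  have e: "range e = D" using False D by (simp add: e_def)
  define B where "B n = (\<Union>t\<in>e ` {..n::nat}. A t)" for n
  have UB: "(\<Union>n. B n) = (\<Union>t\<in>D. A t)" unfolding B_def e[symmetric] by auto
  have "e i \<in> D" for i using e by blast
  then have "range B \<subseteq> sets M" unfolding B_def by (auto intro!: meas)
  moreover have "incseq B" unfolding B_def incseq_def by force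
  ultimately have "(\<lambda>n. measure M (B n)) \<longlonglongrightarrow> measure M (\<Union>n. B n)"
    by (rule finite_Lim_measure_incseq)
  moreover have "measure M (B n) \<le> C" for n unfolding B_def by (rule le) (use e in auto)
  ultimately have "measure M (\<Union>n. B n) \<le> C" by (blast intro: LIMSEQ_le_const2)
  then show ?thesis by (simp only: UB)
qed

context driving_noise
begin

lemma measurable_F_imp_M: "f \<in> F t \<rightarrow>\<^sub>M N' \<Longrightarrow> f \<in> M \<rightarrow>\<^sub>M N'"
  using subalgebra_F measurable_from_subalg by blast

lemma measurable_F_mono: "f \<in> F s \<rightarrow>\<^sub>M N' \<Longrightarrow> s \<le> t \<Longrightarrow> f \<in> F t \<rightarrow>\<^sub>M N'"
  using sets_F_mono[of s t] space_F[of s] space_F[of t] by (auto simp: measurable_def)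

lemma brownian_adapted: "0 \<le> t \<Longrightarrow> w t \<in> borel_measurable (F t)"
  using brownian by (simp add: brownian_motion_def)

lemma brownian_measurable: "0 \<le> t \<Longrightarrow> w t \<in> borel_measurable M"
  using brownian_adapted measurable_F_imp_M by blast

text \<open>Independence passes to smaller families: preimages under \<open>Y\<close> lie in
  \<open>F s\<close>, and a preimage under \<open>f\<close> of the increment is a preimage under the
  increment itself. The form \<open>indep_var\<close> is the one that the product rule for
  expectations takes.\<close>

lemma brownian_indep_increment:
  fixes Y :: "'a \<Rightarrow> real" and f :: "real^'d \<Rightarrow> real"
  assumes st: "0 \<le> s" "s < t" and Y: "Y \<in> borel_measurable (F s)" and f: "f \<in> borel_measurable borel"
  shows "indep_var borel Y borel (\<lambda>\<omega>. f (w t \<omega> - w s \<omega>))"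
proof -
  have ind: "indep_set (sets (F s)) {(\<lambda>\<omega>. w t \<omega> - w s \<omega>) -` B \<inter> space M | B. B \<in> sets borel}"
    using brownian st by (simp add: brownian_motion_def)
  have w: "(\<lambda>\<omega>. w t \<omega> - w s \<omega>) \<in> borel_measurable M"
    using st by (auto intro!: borel_measurable_diff brownian_measurable)
  have "indep_sets (case_bool {Y -` A \<inter> space M |A. A \<in> sets borel}
      {(\<lambda>\<omega>. f (w t \<omega> - w s \<omega>)) -` A \<inter> space M |A. A \<in> sets borel}) UNIV"
  proof (rule indep_sets_mono_sets[OF ind[unfolded indep_set_def]])
    fix i :: bool
    have "{Y -` A \<inter> space M |A. A \<in> sets borel} \<subseteq> sets (F s)"
      using measurable_sets[OF Y] by (auto simp: space_F)
    moreover have "{(\<lambda>\<omega>. f (w t \<omega> - w s \<omega>)) -` A \<inter> space M |A. A \<in> sets borel}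
        \<subseteq> {(\<lambda>\<omega>. w t \<omega> - w s \<omega>) -` B \<inter> space M | B. B \<in> sets borel}"
    proof safe
      fix A :: "real set" assume "A \<in> sets borel"
      then show "\<exists>B. (\<lambda>\<omega>. f (w t \<omega> - w s \<omega>)) -` A \<inter> space M = (\<lambda>\<omega>. w t \<omega> - w s \<omega>) -` B \<inter> space M \<and> B \<in> sets borel"
        using measurable_sets[OF f, of A] by (intro exI[of _ "f -` A"]) auto
    qed
    ultimately show "(case i of True \<Rightarrow> {Y -` A \<inter> space M |A. A \<in> sets borel}
        | False \<Rightarrow> {(\<lambda>\<omega>. f (w t \<omega> - w s \<omega>)) -` A \<inter> space M |A. A \<in> sets borel}) \<subseteq>
      (case i of True \<Rightarrow> sets (F s)
        | False \<Rightarrow> {(\<lambda>\<omega>. w t \<omega> - w s \<omega>) -` B \<inter> space M | B. B \<in> sets borel})"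
      by (cases i) auto
  qed
  moreover have "random_variable borel Y" using Y by (rule measurable_F_imp_M)
  moreover have "random_variable borel (\<lambda>\<omega>. f (w t \<omega> - w s \<omega>))"
    using measurable_compose[OF w f] .
  ultimately show ?thesis
    unfolding indep_var_def indep_vars_def2
    by (auto split: bool.split cong: bool.case_cong elim!: indep_sets_mono_sets
        simp: indep_set_def bool.case_distrib[where h="\<lambda>x. {x -` A \<inter> space M |A. A \<in> sets _}"])
qed

text \<open>The squared norm is a sum of \<open>CARD('d)\<close> squared coordinates, each of
  variance \<open>t - s\<close>; this is where the dimension factor of all later bounds comes
  from.\<close>

lemma brownian_increment_moments:
  assumes st: "0 \<le> s" "s < t"
  shows "integrable M (\<lambda>\<omega>. (w t \<omega> - w s \<omega>) $ j)"
    and "expectation (\<lambda>\<omega>. (w t \<omega> - w s \<omega>) $ j) = 0"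
    and "integrable M (\<lambda>\<omega>. (norm (w t \<omega> - w s \<omega>))\<^sup>2)"
    and "expectation (\<lambda>\<omega>. (norm (w t \<omega> - w s \<omega>))\<^sup>2) = real CARD('d) * (t - s)"
proof -
  have d: "distributed M lborel (\<lambda>\<omega>. (w t \<omega> - w s \<omega>) $ j)
      (\<lambda>y. ennreal (normal_density 0 (sqrt (t - s)) y))" for j
    using brownian st by (simp add: brownian_motion_def)
  have pos: "0 < sqrt (t - s)" using st by simp
  have i1: "integrable M (\<lambda>\<omega>. (w t \<omega> - w s \<omega>) $ j)" for j
    using distributed_integrable[OF d[of j], of "\<lambda>x. x"] integrable_normal_moment_nz_1[OF pos, of 0] 
    by simp
  have e1: "expectation (\<lambda>\<omega>. (w t \<omega> - w s \<omega>) $ j) = 0" for j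
    using normal_distributed_expectation[OF pos d[of j]] .
  have i2: "integrable M (\<lambda>\<omega>. ((w t \<omega> - w s \<omega>) $ j)\<^sup>2)" for j
    using distributed_integrable[OF d[of j], of "\<lambda>x. x\<^sup>2"] integrable_normal_moment[OF pos, of 0 2]
    by simp
  have e2: "expectation (\<lambda>\<omega>. ((w t \<omega> - w s \<omega>) $ j)\<^sup>2) = t - s" for j
    using normal_distributed_variance[OF pos d[of j]] st e1[of j] by (simp del: vector_minus_component)
  have n: "(norm v)\<^sup>2 = (\<Sum>j\<in>UNIV. (v $ j)\<^sup>2)" for v :: "real^'d"
    by (simp add: norm_vec_def L2_set_def sum_nonneg)
  show "integrable M (\<lambda>\<omega>. (w t \<omega> - w s \<omega>) $ j)" "expectation (\<lambda>\<omega>. (w t \<omega> - w s \<omega>) $ j) = 0"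
    using i1 e1 by auto
  show "integrable M (\<lambda>\<omega>. (norm (w t \<omega> - w s \<omega>))\<^sup>2)"
    unfolding n using i2 by (auto intro!: Bochner_Integration.integrable_sum)
  show "expectation (\<lambda>\<omega>. (norm (w t \<omega> - w s \<omega>))\<^sup>2) = real CARD('d) * (t - s)"
    unfolding n using i2 e2 by (simp add: Bochner_Integration.integral_sum del: vector_minus_component)
qed

end

section \<open>Sums of Brownian increments\<close>

text \<open>Cauchy-Schwarz row by row: the Frobenius norm dominates the operator norm.\<close>

lemma norm_matrix_vector_mult_le:
  fixes A :: "real^'n^'m" and x :: "real^'n"
  shows "norm (A *v x) \<le> norm A * norm x"
proof -
  have "(norm (A *v x))\<^sup>2 = (\<Sum>i\<in>UNIV. ((A $ i) \<bullet> x)\<^sup>2)"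
    by (simp add: norm_vec_def L2_set_def sum_nonneg matrix_vector_mult_def inner_vec_def)
  also have "\<dots> \<le> (\<Sum>i\<in>UNIV. (norm (A $ i))\<^sup>2 * (norm x)\<^sup>2)"
    unfolding power2_norm_eq_inner by (intro sum_mono Cauchy_Schwarz_ineq)
  also have "\<dots> = (\<Sum>i\<in>UNIV. (norm (A $ i))\<^sup>2) * (norm x)\<^sup>2"
    by (rule sum_distrib_right[symmetric])
  also have "(\<Sum>i\<in>UNIV. (norm (A $ i))\<^sup>2) = (norm A)\<^sup>2"
    by (simp add: norm_vec_def[of A] L2_set_def sum_nonneg)
  finally have "(norm (A *v x))\<^sup>2 \<le> (norm A * norm x)\<^sup>2"
    by (simp only: power_mult_distrib)
  then show ?thesis by (rule power2_le_imp_le) simp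
qed

lemma bounded_bilinear_matrix_vector_mult:
  "bounded_bilinear ((*v) :: real^'n^'m \<Rightarrow> real^'n \<Rightarrow> real^'m)"
proof
  show "\<exists>K. \<forall>a b. norm (a *v b :: real^'m) \<le> norm (a :: real^'n^'m) * norm b * K"
    by (intro exI[of _ 1]) (simp add: norm_matrix_vector_mult_le)
qed (simp_all add: matrix_vector_mult_add_rdistrib matrix_vector_right_distrib
      matrix_vector_mult_scaleR scaleR_matrix_vector_assoc)

lemma borel_measurable_matrix_vector_mult:
  fixes A :: "'a \<Rightarrow> real^'n^'m"
  assumes "A \<in> borel_measurable M" "x \<in> borel_measurable M"
  shows "(\<lambda>\<omega>. A \<omega> *v x \<omega>) \<in> borel_measurable M"
proof (rule borel_measurable_continuous_Pair[OF assms])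
  show "continuous_on UNIV (\<lambda>p. fst p *v snd p :: real^'m)"
    by (intro bounded_bilinear.continuous_on[OF bounded_bilinear_matrix_vector_mult] continuous_on_fst continuous_on_snd continuous_on_id)
qed

text \<open>Splits the cross term of a squared sum into scalar products of a quantity known at the
  start of an interval with a single coordinate of the increment, to which independence applies
  directly.\<close>

lemma inner_matrix_vector_mult_axis:
  fixes A :: "real^'n^'m"
  shows "y \<bullet> (A *v x) = (\<Sum>j\<in>UNIV. (y \<bullet> (A *v axis j 1)) * x $ j)"
proof -
  have "A *v x = A *v (\<Sum>j\<in>UNIV. x $ j *\<^sub>R axis j 1)"
    using basis_expansion[of x] by (simp add: scalar_mult_eq_scaleR)
  also have "\<dots> = (\<Sum>j\<in>UNIV. A *v (x $ j *\<^sub>R axis j 1))"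
    by (rule linear_sum[OF matrix_vector_mul_linear])
  also have "\<dots> = (\<Sum>j\<in>UNIV. x $ j *\<^sub>R (A *v axis j 1))"
    by (intro sum.cong refl matrix_vector_mult_scaleR)
  finally show ?thesis by (simp add: inner_sum_right mult.commute)
qed

context driving_noise
begin

text \<open>A discrete Ito isometry, in the form of an upper bound. The terms are orthogonal because
  each coefficient is known before its increment. Estimating |A v| by |A| |v| gives away the factor
  \<open>CARD('d)\<close>, which only affects the size of the final constants.\<close>

lemma brownian_sum_second_moment:
  fixes u :: "nat \<Rightarrow> real" and \<zeta> :: "nat \<Rightarrow> 'a \<Rightarrow> real^'d^'n::finite"
  assumes u0: "0 \<le> u 0" and u: "\<And>i. i < n \<Longrightarrow> u i < u (Suc i)"
    and meas: "\<And>i. i < n \<Longrightarrow> \<zeta> i \<in> borel_measurable (F (u i))"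
    and bdd: "\<And>i. i < n \<Longrightarrow> \<exists>C. \<forall>\<omega>\<in>space M. norm (\<zeta> i \<omega>) \<le> C"
  defines "S \<equiv> \<lambda>l \<omega>. \<Sum>i<l. \<zeta> i \<omega> *v (w (u (Suc i)) \<omega> - w (u i) \<omega>)"
  shows "l \<le> n \<Longrightarrow> S l \<in> borel_measurable (F (u l)) \<and> integrable M (\<lambda>\<omega>. (norm (S l \<omega>))\<^sup>2) \<and>
    expectation (\<lambda>\<omega>. (norm (S l \<omega>))\<^sup>2)
      \<le> real CARD('d) * (\<Sum>i<l. expectation (\<lambda>\<omega>. (norm (\<zeta> i \<omega>))\<^sup>2) * (u (Suc i) - u i))"
proof (induction l)
  case 0
  then show ?case by (simp add: S_def)
next
  case (Suc l)
  let ?D = "\<lambda>\<omega>. w (u (Suc l)) \<omega> - w (u l) \<omega>"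
  let ?Z = "\<lambda>\<omega>. \<zeta> l \<omega> *v ?D \<omega>"
  have ln: "l < n" using Suc by simp
  have ul: "0 \<le> u l" using ln
  proof (induction l)
    case (Suc k) then show ?case using u[of k] by simp
  qed (use u0 in simp)
  have us: "u l < u (Suc l)" using u ln by simp
  have S: "S l \<in> borel_measurable (F (u l))" "integrable M (\<lambda>\<omega>. (norm (S l \<omega>))\<^sup>2)"
    "expectation (\<lambda>\<omega>. (norm (S l \<omega>))\<^sup>2)
      \<le> real CARD('d) * (\<Sum>i<l. expectation (\<lambda>\<omega>. (norm (\<zeta> i \<omega>))\<^sup>2) * (u (Suc i) - u i))"
    using Suc by auto
  have SM[measurable]: "S l \<in> borel_measurable M" using S(1) by (rule measurable_F_imp_M)
  have zF: "\<zeta> l \<in> borel_measurable (F (u l))" using meas ln by simp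
  then have [measurable]: "\<zeta> l \<in> borel_measurable M" by (rule measurable_F_imp_M)
  have [measurable]: "w (u l) \<in> borel_measurable M" "w (u (Suc l)) \<in> borel_measurable M"
    using ul us by (auto intro!: brownian_measurable)
  have ZM[measurable]: "?Z \<in> borel_measurable M"
    by (rule borel_measurable_matrix_vector_mult) measurable
  obtain C where C: "\<And>\<omega>. \<omega> \<in> space M \<Longrightarrow> norm (\<zeta> l \<omega>) \<le> C" using bdd[OF ln] by blast
  have SSuc: "S (Suc l) \<omega> = S l \<omega> + ?Z \<omega>" for \<omega> by (simp add: S_def)
  have m: "S (Suc l) \<in> borel_measurable (F (u (Suc l)))"
    unfolding SSuc[abs_def]
  proof (intro borel_measurable_add borel_measurable_matrix_vector_mult borel_measurable_diff)
    show "S l \<in> borel_measurable (F (u (Suc l)))" using measurable_F_mono[OF S(1)] us by simp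
    show "\<zeta> l \<in> borel_measurable (F (u (Suc l)))" using measurable_F_mono[OF zF] us by simp
    show "w (u (Suc l)) \<in> borel_measurable (F (u (Suc l)))" using ul us by (intro brownian_adapted) simp
    show "w (u l) \<in> borel_measurable (F (u (Suc l)))"
      using measurable_F_mono[OF brownian_adapted[OF ul]] us by simp
  qed
  have iz: "integrable M (\<lambda>\<omega>. (norm (\<zeta> l \<omega>))\<^sup>2)"
  proof (rule integrable_const_bound[of _ "C\<^sup>2"])
    show "AE \<omega> in M. norm ((norm (\<zeta> l \<omega>))\<^sup>2) \<le> C\<^sup>2"
      using C by (auto intro!: AE_I2 power_mono)
  qed measurable
  have ind: "indep_var borel (\<lambda>\<omega>. (norm (\<zeta> l \<omega>))\<^sup>2) borel (\<lambda>\<omega>. (norm (?D \<omega>))\<^sup>2)"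
  proof (rule brownian_indep_increment[OF ul us])
    note [measurable] = zF
    show "(\<lambda>\<omega>. (norm (\<zeta> l \<omega>))\<^sup>2) \<in> borel_measurable (F (u l))" by measurable
    show "(\<lambda>x. (norm x)\<^sup>2) \<in> borel_measurable borel" by measurable
  qed
  note mom = brownian_increment_moments[OF ul us]
  have iP: "integrable M (\<lambda>\<omega>. (norm (\<zeta> l \<omega>))\<^sup>2 * (norm (?D \<omega>))\<^sup>2)"
    by (rule indep_var_integrable[OF ind iz mom(3)])
  have eP: "expectation (\<lambda>\<omega>. (norm (\<zeta> l \<omega>))\<^sup>2 * (norm (?D \<omega>))\<^sup>2)
      = expectation (\<lambda>\<omega>. (norm (\<zeta> l \<omega>))\<^sup>2) * (real CARD('d) * (u (Suc l) - u l))"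
    using indep_var_lebesgue_integral[OF ind iz mom(3)] mom(4) by simp
  have Zle: "(norm (?Z \<omega>))\<^sup>2 \<le> (norm (\<zeta> l \<omega>))\<^sup>2 * (norm (?D \<omega>))\<^sup>2" for \<omega>
    using power_mono[OF norm_matrix_vector_mult_le[of "\<zeta> l \<omega>" "?D \<omega>"], of 2]
    by (simp add: power_mult_distrib)
  have iZ: "integrable M (\<lambda>\<omega>. (norm (?Z \<omega>))\<^sup>2)"
    by (rule Bochner_Integration.integrable_bound[OF iP]) (use Zle in \<open>auto intro!: AE_I2\<close>)
  have eZ: "expectation (\<lambda>\<omega>. (norm (?Z \<omega>))\<^sup>2)
      \<le> real CARD('d) * (expectation (\<lambda>\<omega>. (norm (\<zeta> l \<omega>))\<^sup>2) * (u (Suc l) - u l))"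
    using integral_mono[OF iZ iP Zle] eP by (simp add: mult_ac)
  \<comment> \<open>The partial sum is square integrable and the coefficient is bounded by
    \<open>C\<close>, so the first factor is integrable; it is independent of the centred second
    factor.\<close>
  have cross: "integrable M (\<lambda>\<omega>. (S l \<omega> \<bullet> (\<zeta> l \<omega> *v axis j 1)) * ?D \<omega> $ j)"
    "expectation (\<lambda>\<omega>. (S l \<omega> \<bullet> (\<zeta> l \<omega> *v axis j 1)) * ?D \<omega> $ j) = 0" for j
  proof -
    let ?Y = "\<lambda>\<omega>. S l \<omega> \<bullet> (\<zeta> l \<omega> *v axis j 1)"
    have YF: "?Y \<in> borel_measurable (F (u l))"
      by (intro borel_measurable_inner borel_measurable_matrix_vector_mult S(1) zF) simp
    have ind: "indep_var borel ?Y borel (\<lambda>\<omega>. ?D \<omega> $ j)"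
      by (rule brownian_indep_increment[OF ul us YF, where f="\<lambda>x. x $ j"]) measurable
    have "integrable M (\<lambda>\<omega>. norm (S l \<omega>))"
      by (rule square_integrable_imp_integrable) (use S(2) in simp_all)
    then have "integrable M (\<lambda>\<omega>. C * norm (S l \<omega>))" by simp
    then have iY: "integrable M ?Y"
    proof (rule Bochner_Integration.integrable_bound)
      show "?Y \<in> borel_measurable M" using YF by (rule measurable_F_imp_M)
      show "AE \<omega> in M. norm (?Y \<omega>) \<le> norm (C * norm (S l \<omega>))"
      proof (rule AE_I2)
        fix \<omega> assume w: "\<omega> \<in> space M"
        have "\<bar>?Y \<omega>\<bar> \<le> norm (S l \<omega>) * norm (\<zeta> l \<omega> *v axis j 1)" by (rule Cauchy_Schwarz_ineq2)
        also have "\<dots> \<le> norm (S l \<omega>) * C"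
          using norm_matrix_vector_mult_le[of "\<zeta> l \<omega>" "axis j 1"] C[OF w]
          by (intro mult_left_mono) auto
        finally show "norm (?Y \<omega>) \<le> norm (C * norm (S l \<omega>))"
          by (simp add: mult.commute)
      qed
    qed
    show "integrable M (\<lambda>\<omega>. ?Y \<omega> * ?D \<omega> $ j)"
      by (rule indep_var_integrable[OF ind iY mom(1)])
    show "expectation (\<lambda>\<omega>. ?Y \<omega> * ?D \<omega> $ j) = 0"
      using indep_var_lebesgue_integral[OF ind iY mom(1)] mom(2)[of j] by simp
  qed
  have sq: "(norm (S (Suc l) \<omega>))\<^sup>2 = (norm (S l \<omega>))\<^sup>2 +
      2 * (\<Sum>j\<in>UNIV. (S l \<omega> \<bullet> (\<zeta> l \<omega> *v axis j 1)) * ?D \<omega> $ j) + (norm (?Z \<omega>))\<^sup>2" for \<omega>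
    unfolding SSuc inner_matrix_vector_mult_axis[symmetric]
    by (simp add: power2_norm_eq_inner inner_add_left inner_add_right inner_commute)
  have i1: "integrable M (\<lambda>\<omega>. 2 * (\<Sum>j\<in>UNIV. (S l \<omega> \<bullet> (\<zeta> l \<omega> *v axis j 1)) * ?D \<omega> $ j))"
    using cross(1) by (intro integrable_mult_right Bochner_Integration.integrable_sum)
  have e1: "expectation (\<lambda>\<omega>. 2 * (\<Sum>j\<in>UNIV. (S l \<omega> \<bullet> (\<zeta> l \<omega> *v axis j 1)) * ?D \<omega> $ j)) = 0"
    using cross by (simp add: Bochner_Integration.integral_sum del: vector_minus_component)
  have "integrable M (\<lambda>\<omega>. (norm (S (Suc l) \<omega>))\<^sup>2)"
    unfolding sq by (intro Bochner_Integration.integrable_add S(2) i1 iZ)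
  moreover have "expectation (\<lambda>\<omega>. (norm (S (Suc l) \<omega>))\<^sup>2)
      = expectation (\<lambda>\<omega>. (norm (S l \<omega>))\<^sup>2) + expectation (\<lambda>\<omega>. (norm (?Z \<omega>))\<^sup>2)"
    unfolding sq using S(2) i1 iZ e1 
    by (simp only: Bochner_Integration.integral_add Bochner_Integration.integrable_add)
  ultimately show ?case using m S(3) eZ by (simp add: algebra_simps)
qed

end

lemma strict_increasing_enumeration:
  fixes G :: "real set"
  assumes "finite G" "G \<noteq> {}"
  obtains n :: nat and u where "u ` {..n} = G" "\<And>i. i < n \<Longrightarrow> u i < u (Suc i)" "u 0 = Min G"
proof
  let ?L = "sorted_list_of_set G"
  let ?n = "card G - 1"
  have c: "card G > 0" using assms by (simp add: card_gt_0_iff)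
  have len: "length ?L = Suc ?n" using c by simp
  show "(!) ?L ` {..?n} = G"
  proof -
    have "G = {?L ! i | i. i < length ?L}"
      unfolding set_conv_nth[symmetric] using assms(1) by simp
    also have "\<dots> = (!) ?L ` {..?n}" unfolding len less_Suc_eq_le by auto
    finally show ?thesis by (rule sym)
  qed
  show "?L ! i < ?L ! Suc i" if "i < ?n" for i
    using that len sorted_wrt_nth_less[OF strict_sorted_list_of_set[of G], of i "Suc i"] by simp
  show "?L ! 0 = Min G"
    by (subst sorted_list_of_set_nonempty[OF assms]) simp
qed

text \<open>Since \<open>a\<close> and \<open>b\<close> are grid points, each grid interval lies
  entirely inside or entirely outside \<open>(a, b]\<close>, and the increments over those inside
  telescope.\<close>

lemma telescope_clamped:
  fixes u :: "nat \<Rightarrow> real" and f :: "real \<Rightarrow> 'v::ab_group_add"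
  assumes u: "\<And>i. i < n \<Longrightarrow> u i < u (Suc i)"
    and a: "a \<in> u ` {..n}" and b: "b \<in> u ` {..n}" and ab: "a \<le> b"
  shows "l \<le> n \<Longrightarrow> (\<Sum>j<l. if a < u (Suc j) \<and> u (Suc j) \<le> b then f (u (Suc j)) - f (u j) else 0)
      = f (min (u l) b) - f (min (u l) a)"
proof (induction l)
  have mono: "u i \<le> u j" if "i \<le> j" "j \<le> n" for i j
    using that
  proof (induction j)
    case (Suc j)
    then show ?case using u[of j] by (cases "i = Suc j") auto
  qed simp
  \<comment> \<open>No grid point lies strictly between two neighbours.\<close>
  have gap: "c \<le> u l" if "c \<in> u ` {..n}" "c < u (Suc l)" "Suc l \<le> n" for c l
  proof -
    obtain i where i: "c = u i" "i \<le> n" using \<open>c \<in> u ` {..n}\<close> by blast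
    have "\<not> Suc l \<le> i" using mono[of "Suc l" i] i that by auto
    then show ?thesis using mono[of i l] i that by auto
  qed
  {
    case 0
    then show ?case using mono[of 0] a b by (auto simp: min_def)
  next
    case (Suc l)
    have "u l < u (Suc l)" using u Suc by simp
    then show ?case
      using Suc gap[OF a, of l] gap[OF b, of l] ab
      by (cases "a < u (Suc l)"; cases "u (Suc l) \<le> b") (auto simp: min_def)
  }
qed

context driving_noise
begin

text \<open>
  The sum is stopped at the first grid point where it exceeds \<open>\<epsilon>\<close> or its bracket reaches \<open>\<eta>\<close>; Chebyshev's
  inequality for the terminal value of the stopped sum then replaces Doob's inequality.
\<close>

lemma brownian_sum_maximal:
  fixes u :: "nat \<Rightarrow> real" and \<zeta> :: "nat \<Rightarrow> 'a \<Rightarrow> real^'d^'n::finite"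
  assumes u0: "0 \<le> u 0" and u: "\<And>i. i < n \<Longrightarrow> u i < u (Suc i)"
    and meas: "\<And>i. i < n \<Longrightarrow> \<zeta> i \<in> borel_measurable (F (u i))"
    and bdd: "\<And>i. i < n \<Longrightarrow> \<exists>C. \<forall>\<omega>\<in>space M. norm (\<zeta> i \<omega>) \<le> C"
    and \<epsilon>: "0 < \<epsilon>" and \<eta>: "0 \<le> \<eta>"
  defines "S \<equiv> \<lambda>l \<omega>. \<Sum>i<l. \<zeta> i \<omega> *v (w (u (Suc i)) \<omega> - w (u i) \<omega>)"
    and "Q \<equiv> \<lambda>l \<omega>. \<Sum>i<l. (norm (\<zeta> i \<omega>))\<^sup>2 * (u (Suc i) - u i)"
  shows "prob {\<omega>\<in>space M. \<exists>l\<le>n. \<epsilon> < norm (S l \<omega>) \<and> Q l \<omega> < \<eta>} \<le> real CARD('d) * \<eta> / \<epsilon>\<^sup>2"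
proof -
  \<comment> \<open>The bracket is tested with the current term included, at index
    \<open>Suc i\<close>. This is admissible because that term is already known at time
    \<open>u i\<close>, and it keeps the bracket of the stopped sum below \<open>\<eta>\<close>
    without any overshoot.\<close>
  define \<xi> where "\<xi> i \<omega> = (if (\<forall>j\<in>{..i}. norm (S j \<omega>) \<le> \<epsilon>) \<and> Q (Suc i) \<omega> < \<eta> then \<zeta> i \<omega> else 0)" for i \<omega>
  define T where "T = (\<lambda>l \<omega>. \<Sum>i<l. \<xi> i \<omega> *v (w (u (Suc i)) \<omega> - w (u i) \<omega>))"
  have umono: "u i \<le> u j" if "i \<le> j" "j \<le> n" for i j
    using that
  proof (induction j)
    case (Suc j)
    then show ?case using u[of j] by (cases "i = Suc j") auto
  qed simp
  have SF: "S l \<in> borel_measurable (F (u l))" if "l \<le> n" for l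
    using brownian_sum_second_moment[OF u0 u meas bdd that] by (simp add: S_def)
  have \<zeta>F: "\<zeta> i \<in> borel_measurable (F (u j))" if "i \<le> j" "j < n" for i j
    using measurable_F_mono[OF meas[of i] umono[of i j]] that by simp
  have QF: "Q l \<in> borel_measurable (F (u j))" if "l \<le> Suc j" "j < n" for l j
  proof -
    have "(\<lambda>\<omega>. (norm (\<zeta> i \<omega>))\<^sup>2 * (u (Suc i) - u i)) \<in> borel_measurable (F (u j))" if "i < l" for i
    proof -
      have [measurable]: "\<zeta> i \<in> borel_measurable (F (u j))"
        using \<zeta>F \<open>l \<le> Suc j\<close> \<open>j < n\<close> that by simp
      show ?thesis by measurable
    qed
    then show ?thesis unfolding Q_def by (intro borel_measurable_sum) simp
  qed
  have \<xi>F: "\<xi> i \<in> borel_measurable (F (u i))" if i: "i < n" for i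
  proof -
    have [measurable]: "S j \<in> borel_measurable (F (u i))" if "j \<le> i" for j
      using measurable_F_mono[OF SF umono] that i by simp
    have [measurable]: "Q (Suc i) \<in> borel_measurable (F (u i))" using QF i by simp
    have [measurable]: "\<zeta> i \<in> borel_measurable (F (u i))" using \<zeta>F i by simp
    have [measurable]: "Measurable.pred (F (u i)) (\<lambda>\<omega>. \<forall>j\<in>{..i}. norm (S j \<omega>) \<le> \<epsilon>)"
      by measurable
    show ?thesis unfolding \<xi>_def by measurable
  qed
  have \<xi>le: "norm (\<xi> i \<omega>) \<le> norm (\<zeta> i \<omega>)" for i \<omega> by (simp add: \<xi>_def)
  have \<xi>b: "\<exists>C. \<forall>\<omega>\<in>space M. norm (\<xi> i \<omega>) \<le> C" if "i < n" for i
    using bdd[OF that] \<xi>le by (meson order_trans)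
  have T: "T n \<in> borel_measurable (F (u n))" "integrable M (\<lambda>\<omega>. (norm (T n \<omega>))\<^sup>2)"
    "expectation (\<lambda>\<omega>. (norm (T n \<omega>))\<^sup>2)
      \<le> real CARD('d) * (\<Sum>i<n. expectation (\<lambda>\<omega>. (norm (\<xi> i \<omega>))\<^sup>2) * (u (Suc i) - u i))"
    using brownian_sum_second_moment[OF u0 u \<xi>F \<xi>b order_refl] by (simp_all add: T_def)
  have i\<xi>: "integrable M (\<lambda>\<omega>. (norm (\<xi> i \<omega>))\<^sup>2)" if i: "i < n" for i
  proof -
    obtain C where C: "\<And>\<omega>. \<omega> \<in> space M \<Longrightarrow> norm (\<xi> i \<omega>) \<le> C" using \<xi>b[OF i] by blast
    have [measurable]: "\<xi> i \<in> borel_measurable M" using \<xi>F[OF i] by (rule measurable_F_imp_M)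
    show ?thesis
    proof (rule integrable_const_bound[of _ "C\<^sup>2"])
      show "AE \<omega> in M. norm ((norm (\<xi> i \<omega>))\<^sup>2) \<le> C\<^sup>2"
        using C by (auto intro!: AE_I2 power_mono)
    qed measurable
  qed
  \<comment> \<open>A vanishing coefficient adds nothing; a nonvanishing one certifies that the full
    bracket, which dominates the stopped one, is still below \<open>\<eta>\<close>.\<close>
  have sum_le: "(\<Sum>i<l. (norm (\<xi> i \<omega>))\<^sup>2 * (u (Suc i) - u i)) \<le> \<eta>" if "l \<le> n" for l \<omega>
    using that
  proof (induction l)
    case 0
    then show ?case using \<eta> by simp
  next
    case (Suc l)
    show ?case
    proof (cases "\<xi> l \<omega> = 0")
      case True
      then show ?thesis using Suc by simp
    next
      case False
      then have "Q (Suc l) \<omega> < \<eta>" by (auto simp: \<xi>_def split: if_splits)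
      moreover have "(\<Sum>i<Suc l. (norm (\<xi> i \<omega>))\<^sup>2 * (u (Suc i) - u i)) \<le> Q (Suc l) \<omega>"
        unfolding Q_def using u Suc.prems
        by (intro sum_mono mult_right_mono power_mono \<xi>le) (auto intro!: less_imp_le)
      ultimately show ?thesis by simp
    qed
  qed
  have "(\<Sum>i<n. expectation (\<lambda>\<omega>. (norm (\<xi> i \<omega>))\<^sup>2) * (u (Suc i) - u i))
      = expectation (\<lambda>\<omega>. \<Sum>i<n. (norm (\<xi> i \<omega>))\<^sup>2 * (u (Suc i) - u i))"
    using i\<xi> by (simp add: Bochner_Integration.integral_sum)
  also have "\<dots> \<le> expectation (\<lambda>\<omega>. \<eta>)"
    using i\<xi> by (intro integral_mono sum_le Bochner_Integration.integrable_sum) auto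
  also have "\<dots> = \<eta>" by (simp add: prob_space)
  finally have ET: "expectation (\<lambda>\<omega>. (norm (T n \<omega>))\<^sup>2) \<le> real CARD('d) * \<eta>"
    using T(3) by (meson mult_left_mono of_nat_0_le_iff order_trans)
  have TM[measurable]: "T n \<in> borel_measurable M" using T(1) by (rule measurable_F_imp_M)
  have "prob {\<omega>\<in>space M. \<exists>l\<le>n. \<epsilon> < norm (S l \<omega>) \<and> Q l \<omega> < \<eta>}
      \<le> prob {\<omega>\<in>space M. \<epsilon>\<^sup>2 \<le> (norm (T n \<omega>))\<^sup>2}"
  proof (rule finite_measure_mono)
    show "{\<omega>\<in>space M. \<epsilon>\<^sup>2 \<le> (norm (T n \<omega>))\<^sup>2} \<in> events" by measurable
    show "{\<omega>\<in>space M. \<exists>l\<le>n. \<epsilon> < norm (S l \<omega>) \<and> Q l \<omega> < \<eta>}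
        \<subseteq> {\<omega>\<in>space M. \<epsilon>\<^sup>2 \<le> (norm (T n \<omega>))\<^sup>2}"
    proof safe
      fix \<omega> l assume l: "l \<le> n" "\<epsilon> < norm (S l \<omega>)" "Q l \<omega> < \<eta>"
      \<comment> \<open>At the first exceedance \<open>k\<close> the stopped sum freezes. No earlier
        term was cut off, because the bracket is increasing and still below \<open>\<eta>\<close> at
        \<open>l\<close> >= \<open>k\<close>. Thus the terminal value \<open>T n\<close> equals
        \<open>S k\<close>.\<close>
      obtain k where k: "\<epsilon> < norm (S k \<omega>)" and kmin: "\<And>j. j < k \<Longrightarrow> norm (S j \<omega>) \<le> \<epsilon>"
        using l(2) exists_least_iff[of "\<lambda>k. \<epsilon> < norm (S k \<omega>)"] by (auto simp: not_less)
      have kl: "k \<le> l" using kmin[of l] l(2) by linarith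
      have Qk: "Q (Suc i) \<omega> < \<eta>" if "i < k" for i
      proof -
        have "Q (Suc i) \<omega> \<le> Q l \<omega>"
          unfolding Q_def using that kl l(1) u by (intro sum_mono2 mult_nonneg_nonneg) (auto intro: less_imp_le)
        then show ?thesis using l(3) by simp
      qed
      have "T n \<omega> = T k \<omega> + (\<Sum>i=k..<n. \<xi> i \<omega> *v (w (u (Suc i)) \<omega> - w (u i) \<omega>))"
        unfolding T_def using kl l(1) by (simp add: sum.atLeastLessThan_concat flip: atLeast0LessThan)
      also have "(\<Sum>i=k..<n. \<xi> i \<omega> *v (w (u (Suc i)) \<omega> - w (u i) \<omega>)) = 0"
        using k by (intro sum.neutral ballI) (auto simp: \<xi>_def dest!: bspec[of _ _ k])
      also have "T k \<omega> = S k \<omega>"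
        unfolding T_def S_def using kmin Qk by (intro sum.cong) (auto simp: \<xi>_def)
      finally have "\<epsilon> \<le> norm (T n \<omega>)" using k by simp
      then show "\<epsilon>\<^sup>2 \<le> (norm (T n \<omega>))\<^sup>2" using \<epsilon> by (intro power_mono) auto
    qed
  qed
  also have "\<dots> \<le> expectation (\<lambda>\<omega>. (norm (T n \<omega>))\<^sup>2) / \<epsilon>\<^sup>2"
    using integral_Markov_inequality_measure[OF T(2), of "{}" "\<epsilon>\<^sup>2"] \<epsilon> by simp
  also have "\<dots> \<le> real CARD('d) * \<eta> / \<epsilon>\<^sup>2" using ET by (intro divide_right_mono) auto
  finally show ?thesis .
qed

end

section \<open>A maximal inequality for the Ito integral\<close>

lemma nn_integral_grid:
  fixes u :: "nat \<Rightarrow> real" and f :: "real \<Rightarrow> ennreal"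
  assumes u0: "u 0 = 0" and u: "\<And>i. i < n \<Longrightarrow> u i \<le> u (Suc i)"
    and f: "\<And>i s. i < n \<Longrightarrow> u i < s \<Longrightarrow> s \<le> u (Suc i) \<Longrightarrow> f s = ennreal (c i)"
    and c: "\<And>i. 0 \<le> c i" and meas: "f \<in> borel_measurable borel"
  shows "l \<le> n \<Longrightarrow> (\<integral>\<^sup>+s\<in>{0..u l}. f s \<partial>lborel) = ennreal (\<Sum>i<l. c i * (u (Suc i) - u i))"
proof (induction l)
  case 0
  then show ?case by (simp add: u0 nn_integral_indicator_singleton)
next
  case (Suc l)
  note [measurable] = meas
  have ul: "0 \<le> u l" using Suc.prems
  proof (induction l)
    case (Suc k) then show ?case using u[of k] by simp
  qed (simp add: u0)
  have us: "u l \<le> u (Suc l)" using u Suc by simp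
  have "(\<integral>\<^sup>+s\<in>{0..u (Suc l)}. f s \<partial>lborel)
      = (\<integral>\<^sup>+s. f s * indicator {0..u l} s + ennreal (c l) * indicator {u l<..u (Suc l)} s \<partial>lborel)"
    using ul us f[of l] Suc.prems
    by (intro nn_integral_cong) (auto simp: indicator_def)
  also have "\<dots> = (\<integral>\<^sup>+s\<in>{0..u l}. f s \<partial>lborel) + ennreal (c l) * ennreal (u (Suc l) - u l)"
    using us by (subst nn_integral_add) (auto simp: nn_integral_cmult)
  also have "\<dots> = ennreal (\<Sum>i<l. c i * (u (Suc i) - u i)) + ennreal (c l * (u (Suc l) - u l))"
    using Suc us c by (simp add: ennreal_mult'')
  also have "\<dots> = ennreal (\<Sum>i<Suc l. c i * (u (Suc i) - u i))"
    using Suc.prems us u c by (subst ennreal_plus[symmetric]) (auto intro!: sum_nonneg mult_nonneg_nonneg)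
  finally show ?case .
qed

context driving_noise
begin

lemma simple_process_measurable:
  fixes \<xi> :: "nat \<Rightarrow> 'a \<Rightarrow> 'b::euclidean_space"
  assumes "simple_data M F k \<tau> \<xi>"
  shows "(\<lambda>(s, \<omega>). simple_process k \<tau> \<xi> s \<omega>) \<in> borel_measurable (borel \<Otimes>\<^sub>M M)"
proof -
  have "\<xi> i \<in> borel_measurable M" if "i < k" for i
    using assms that measurable_F_imp_M[of "\<xi> i" "\<tau> i" borel] by (auto simp: simple_data_def)
  then have \<xi>: "(\<lambda>p. \<xi> i (snd p)) \<in> borel_measurable (borel \<Otimes>\<^sub>M M)" if "i < k" for i
    using that by (intro measurable_compose[OF measurable_snd]) simp
  have ind: "(\<lambda>p. indicat_real {\<tau> i<..\<tau> (Suc i)} (fst p)) \<in> borel_measurable (borel \<Otimes>\<^sub>M M)" for i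
    by measurable
  show ?thesis unfolding simple_process_def case_prod_beta
    by (intro borel_measurable_sum borel_measurable_scaleR ind \<xi>) auto
qed

lemma simple_integral_measurable:
  assumes "simple_data M F k \<tau> \<xi>" and t: "0 \<le> t"
  shows "simple_integral w k \<tau> \<xi> t \<in> borel_measurable M"
proof -
  have \<xi>: "\<xi> i \<in> borel_measurable M" if "i < k" for i
    using assms that measurable_F_imp_M[of "\<xi> i" "\<tau> i" borel] by (auto simp: simple_data_def)
  have \<tau>: "0 \<le> \<tau> i" if "i \<le> k" for i
    using that
  proof (induction i)
    case (Suc i)
    then have "\<tau> i \<le> \<tau> (Suc i)" using assms by (simp add: simple_data_def)
    then show ?case using Suc by simp
  qed (use assms in \<open>simp add: simple_data_def\<close>)
  show ?thesis unfolding simple_integral_def[abs_def]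
    by (intro borel_measurable_sum borel_measurable_matrix_vector_mult borel_measurable_diff
        brownian_measurable \<xi>) (use \<tau> t in auto)
qed

text \<open>On a common refinement of the partition and the times in \<open>T\<close>, the integral
  and its bracket become partial sums over one grid, so the inequality for sums of increments
  applies.\<close>

lemma simple_integral_maximal:
  fixes \<xi> :: "nat \<Rightarrow> 'a \<Rightarrow> real^'d^'n::finite"
  assumes sd: "simple_data M F k \<tau> \<xi>" and T: "finite T" "T \<subseteq> {0..}"
    and \<epsilon>: "0 < \<epsilon>" and \<eta>: "0 \<le> \<eta>"
  shows "prob {\<omega>\<in>space M. \<exists>t\<in>T. \<epsilon> < norm (simple_integral w k \<tau> \<xi> t \<omega>) \<and>
      (\<integral>\<^sup>+s\<in>{0..t}. ennreal ((norm (simple_process k \<tau> \<xi> s \<omega>))\<^sup>2) \<partial>lborel) < ennreal \<eta>}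
    \<le> real CARD('d) * \<eta> / \<epsilon>\<^sup>2" (is "prob ?E \<le> _")
proof -
  have \<tau>le: "\<tau> i \<le> \<tau> (Suc i)" if "i < k" for i using sd that by (simp add: simple_data_def)
  have \<xi>F: "\<xi> i \<in> borel_measurable (F (\<tau> i))" if "i < k" for i using sd that by (simp add: simple_data_def)
  have \<xi>b: "\<exists>C. \<forall>\<omega>\<in>space M. norm (\<xi> i \<omega>) \<le> C" if "i < k" for i using sd that by (simp add: simple_data_def)
  have \<tau>0: "0 \<le> \<tau> i" if "i \<le> k" for i
    using that
  proof (induction i)
    case (Suc i)
    then show ?case using \<tau>le[of i] by simp
  qed (use sd in \<open>simp add: simple_data_def\<close>)
  \<comment> \<open>The point 0 is added so that the grid starts where the bracket does.\<close>
  define G where "G = insert 0 (T \<union> \<tau> ` {..k})"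
  have G: "finite G" "G \<noteq> {}" unfolding G_def using T by auto
  obtain n u where uG: "u ` {..n} = G" and u: "\<And>i. i < n \<Longrightarrow> u i < u (Suc i)" and "u 0 = Min G"
    using strict_increasing_enumeration[OF G] by blast
  have "Min G = 0" using T \<tau>0 by (intro Min_eqI G) (auto simp: G_def)
  then have u0: "u 0 = 0" using \<open>u 0 = Min G\<close> by simp
  have umono: "u i \<le> u j" if "i \<le> j" "j \<le> n" for i j
    using that
  proof (induction j)
    case (Suc j)
    then show ?case using u[of j] by (cases "i = Suc j") auto
  qed simp
  have gap: "c \<le> u l" if c: "c \<in> G" "c < u (Suc l)" "Suc l \<le> n" for c l
  proof -
    obtain i where i: "c = u i" "i \<le> n" using c(1) uG by blast
    have "\<not> Suc l \<le> i" using umono[of "Suc l" i] i c by auto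
    then show ?thesis using umono[of i l] i c by auto
  qed
  have \<tau>G: "\<tau> i \<in> G" if "i \<le> k" for i using that by (auto simp: G_def)
  \<comment> \<open>The process is constant on left-open grid intervals, so its value there is read
    off at the right end point. That value is nevertheless known at the left end:
    \<open>\<tau> i < u (Suc j)\<close> forces \<open>\<tau> i \<le> u j\<close>, by
    \<open>gap\<close>.\<close>
  let ?\<zeta> = "\<lambda>j \<omega>. simple_process k \<tau> \<xi> (u (Suc j)) \<omega>"
  have \<zeta>F: "?\<zeta> j \<in> borel_measurable (F (u j))" if j: "j < n" for j
  proof -
    have "(\<lambda>\<omega>. indicator {\<tau> i<..\<tau> (Suc i)} (u (Suc j)) *\<^sub>R \<xi> i \<omega>) \<in> borel_measurable (F (u j))"
      if i: "i < k" for i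
    proof (cases "\<tau> i < u (Suc j)")
      case True
      then have "\<xi> i \<in> borel_measurable (F (u j))"
        using measurable_F_mono[OF \<xi>F[OF i]] gap[OF \<tau>G[of i], of j] i j by simp
      then show ?thesis by (intro borel_measurable_scaleR) auto
    qed simp
    then show ?thesis unfolding simple_process_def by (intro borel_measurable_sum) simp
  qed
  have \<zeta>b: "\<exists>C. \<forall>\<omega>\<in>space M. norm (?\<zeta> j \<omega>) \<le> C" for j
  proof -
    obtain C where C: "\<And>i \<omega>. i < k \<Longrightarrow> \<omega> \<in> space M \<Longrightarrow> norm (\<xi> i \<omega>) \<le> C i" using \<xi>b by metis
    have "norm (?\<zeta> j \<omega>) \<le> (\<Sum>i<k. C i)" if "\<omega> \<in> space M" for \<omega>
      unfolding simple_process_def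
    proof (rule sum_norm_le)
      fix i assume "i \<in> {..<k}"
      then have "norm (\<xi> i \<omega>) \<le> C i" using C that by simp
      then show "norm (indicator {\<tau> i<..\<tau> (Suc i)} (u (Suc j)) *\<^sub>R \<xi> i \<omega>) \<le> C i"
        by (auto simp: indicator_def intro: order_trans[OF norm_ge_zero])
    qed
    then show ?thesis by blast
  qed
  have SI: "simple_integral w k \<tau> \<xi> (u l) \<omega>
      = (\<Sum>j<l. ?\<zeta> j \<omega> *v (w (u (Suc j)) \<omega> - w (u j) \<omega>))" if l: "l \<le> n" for l \<omega>
  proof -
    have "simple_integral w k \<tau> \<xi> (u l) \<omega> = (\<Sum>i<k. \<xi> i \<omega> *v
        (\<Sum>j<l. if \<tau> i < u (Suc j) \<and> u (Suc j) \<le> \<tau> (Suc i) then w (u (Suc j)) \<omega> - w (u j) \<omega> else 0))"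
      unfolding simple_integral_def
    proof (intro sum.cong refl)
      fix i assume "i \<in> {..<k}"
      then show "\<xi> i \<omega> *v (w (min (u l) (\<tau> (Suc i))) \<omega> - w (min (u l) (\<tau> i)) \<omega>) = \<xi> i \<omega> *v
        (\<Sum>j<l. if \<tau> i < u (Suc j) \<and> u (Suc j) \<le> \<tau> (Suc i) then w (u (Suc j)) \<omega> - w (u j) \<omega> else 0)"
        by (subst telescope_clamped[where f="\<lambda>t. w t \<omega>" and u=u and n=n, OF u _ _ _ l]) (auto simp: uG \<tau>G \<tau>le)
    qed
    also have "\<dots> = (\<Sum>i<k. \<Sum>j<l. (indicator {\<tau> i<..\<tau> (Suc i)} (u (Suc j)) *\<^sub>R \<xi> i \<omega>)
        *v (w (u (Suc j)) \<omega> - w (u j) \<omega>))"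
      by (intro sum.cong refl)
        (auto simp: linear_sum[OF matrix_vector_mul_linear] indicator_def intro!: sum.cong)
    also have "\<dots> = (\<Sum>j<l. ?\<zeta> j \<omega> *v (w (u (Suc j)) \<omega> - w (u j) \<omega>))"
      unfolding simple_process_def
      by (subst sum.swap) (simp only: bounded_bilinear.sum_left[OF bounded_bilinear_matrix_vector_mult])
    finally show ?thesis .
  qed
  have const: "simple_process k \<tau> \<xi> s \<omega> = ?\<zeta> j \<omega>" if s: "u j < s" "s \<le> u (Suc j)" and j: "j < n" for s j \<omega>
    unfolding simple_process_def
  proof (intro sum.cong refl)
    fix i assume i: "i \<in> {..<k}"
    have "\<tau> i < s \<longleftrightarrow> \<tau> i < u (Suc j)" "s \<le> \<tau> (Suc i) \<longleftrightarrow> u (Suc j) \<le> \<tau> (Suc i)"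
      using gap[OF \<tau>G[of i], of j] gap[OF \<tau>G[of "Suc i"], of j] i j s by fastforce+
    then show "indicator {\<tau> i<..\<tau> (Suc i)} s *\<^sub>R \<xi> i \<omega>
        = indicator {\<tau> i<..\<tau> (Suc i)} (u (Suc j)) *\<^sub>R \<xi> i \<omega>"
      by (simp add: indicator_def)
  qed
  have Q: "(\<integral>\<^sup>+s\<in>{0..u l}. ennreal ((norm (simple_process k \<tau> \<xi> s \<omega>))\<^sup>2) \<partial>lborel)
      = ennreal (\<Sum>j<l. (norm (?\<zeta> j \<omega>))\<^sup>2 * (u (Suc j) - u j))" if l: "l \<le> n" for l \<omega>
  proof (rule nn_integral_grid[where u=u, OF u0 _ _ _ _ l])
    show "(\<lambda>s. ennreal ((norm (simple_process k \<tau> \<xi> s \<omega>))\<^sup>2)) \<in> borel_measurable borel"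
      unfolding simple_process_def by measurable
  qed (use u const in \<open>auto intro: less_imp_le\<close>)
  have "?E \<subseteq> {\<omega>\<in>space M. \<exists>l\<le>n. \<epsilon> < norm (\<Sum>j<l. ?\<zeta> j \<omega> *v (w (u (Suc j)) \<omega> - w (u j) \<omega>)) \<and>
      (\<Sum>j<l. (norm (?\<zeta> j \<omega>))\<^sup>2 * (u (Suc j) - u j)) < \<eta>}" (is "_ \<subseteq> ?E'")
  proof safe
    fix \<omega> t assume *: "t \<in> T" "\<epsilon> < norm (simple_integral w k \<tau> \<xi> t \<omega>)"
      "(\<integral>\<^sup>+s\<in>{0..t}. ennreal ((norm (simple_process k \<tau> \<xi> s \<omega>))\<^sup>2) \<partial>lborel) < ennreal \<eta>"
    have "t \<in> u ` {..n}" using * unfolding uG G_def by simp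
    then obtain l where l: "l \<le> n" "t = u l" by auto
    have "0 \<le> (\<Sum>j<l. (norm (?\<zeta> j \<omega>))\<^sup>2 * (u (Suc j) - u j))"
      using u l by (intro sum_nonneg mult_nonneg_nonneg) (auto intro: less_imp_le)
    then show "\<exists>l\<le>n. \<epsilon> < norm (\<Sum>j<l. ?\<zeta> j \<omega> *v (w (u (Suc j)) \<omega> - w (u j) \<omega>)) \<and>
        (\<Sum>j<l. (norm (?\<zeta> j \<omega>))\<^sup>2 * (u (Suc j) - u j)) < \<eta>"
      using *(2,3) SI[OF l(1)] Q[OF l(1)] l by (intro exI[of _ l]) (simp add: ennreal_less_iff)
  qed
  moreover have "?E' \<in> events"
  proof -
    have [measurable]: "?\<zeta> j \<in> borel_measurable M" if "j < n" for j
      using \<zeta>F[OF that] by (rule measurable_F_imp_M)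
    have [measurable]: "w (u j) \<in> borel_measurable M" if "j \<le> n" for j
      using umono[of 0 j] that u0 by (intro brownian_measurable) simp
    have [measurable]: "(\<lambda>\<omega>. \<Sum>j<l. ?\<zeta> j \<omega> *v (w (u (Suc j)) \<omega> - w (u j) \<omega>)) \<in> borel_measurable M"
      if "l \<in> {..n}" for l
      by (intro borel_measurable_sum borel_measurable_matrix_vector_mult borel_measurable_diff)
        (use that in auto)
    have [measurable]: "(\<lambda>\<omega>. \<Sum>j<l. (norm (?\<zeta> j \<omega>))\<^sup>2 * (u (Suc j) - u j)) \<in> borel_measurable M"
      if "l \<in> {..n}" for l
      by (intro borel_measurable_sum) (use that in auto)
    have "{\<omega>\<in>space M. \<exists>l\<in>{..n}. \<epsilon> < norm (\<Sum>j<l. ?\<zeta> j \<omega> *v (w (u (Suc j)) \<omega> - w (u j) \<omega>)) \<and>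
      (\<Sum>j<l. (norm (?\<zeta> j \<omega>))\<^sup>2 * (u (Suc j) - u j)) < \<eta>} \<in> events"
      by measurable
    then show ?thesis by (simp add: Bex_def)
  qed
  ultimately have "prob ?E \<le> prob ?E'" by (rule finite_measure_mono)
  also have "\<dots> \<le> real CARD('d) * \<eta> / \<epsilon>\<^sup>2"
    by (rule brownian_sum_maximal[where u=u, OF _ u \<zeta>F \<zeta>b \<epsilon> \<eta>]) (use u0 in auto)
  finally show ?thesis .
qed

end

section \<open>Passage from simple integrands to the Ito integral\<close>

text \<open>Progressive measurability gives joint measurability on \<open>[0, T]\<close> only, so
  Lebesgue measure is restricted to that interval before integrating out the time.\<close>

lemma nn_integral_interval_measurable:
  fixes G :: "real \<Rightarrow> 'a \<Rightarrow> ennreal"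
  assumes "(\<lambda>(s, \<omega>). G s \<omega>) \<in> borel_measurable (restrict_space borel {0..T} \<Otimes>\<^sub>M M)"
  shows "(\<lambda>\<omega>. \<integral>\<^sup>+s\<in>{0..T}. G s \<omega> \<partial>lborel) \<in> borel_measurable M"
proof -
  interpret R: finite_measure "restrict_space lborel {0..T}"
    by (rule finite_measureI) (simp add: emeasure_restrict_space space_restrict_space emeasure_lborel_Icc_eq)
  have "(\<lambda>(s, \<omega>). G s \<omega>) \<in> borel_measurable (restrict_space lborel {0..T} \<Otimes>\<^sub>M M)"
    using assms by (simp cong: measurable_cong_sets add: sets_restrict_space_cong[of lborel borel])
  then have "(\<lambda>(\<omega>, s). G s \<omega>) \<in> borel_measurable (M \<Otimes>\<^sub>M restrict_space lborel {0..T})"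
    by (subst measurable_pair_swap_iff) (simp add: case_prod_beta)
  then have "(\<lambda>\<omega>. \<integral>\<^sup>+s. G s \<omega> \<partial>restrict_space lborel {0..T}) \<in> borel_measurable M"
    by (rule R.borel_measurable_nn_integral)
  then show ?thesis by (simp add: nn_integral_restrict_space)
qed

context driving_noise
begin

lemma progressively_measurable_jointly:
  assumes "progressively_measurable F H" "0 \<le> T"
  shows "(\<lambda>(s, \<omega>). H s \<omega>) \<in> borel_measurable (restrict_space borel {0..T} \<Otimes>\<^sub>M M)"
proof -
  have "(\<lambda>x. x) \<in> M \<rightarrow>\<^sub>M F T"
    using subalgebra_F[of T] by (auto simp: measurable_def subalgebra_def sets.Int_space_eq2 intro: set_mp)
  then have "(\<lambda>p. (fst p, snd p)) \<in> restrict_space borel {0..T} \<Otimes>\<^sub>M M \<rightarrow>\<^sub>M restrict_space borel {0..T} \<Otimes>\<^sub>M F T"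
    by (intro measurable_Pair measurable_fst measurable_compose[OF measurable_snd])
  moreover have "(\<lambda>(s, \<omega>). H s \<omega>) \<in> borel_measurable (restrict_space borel {0..T} \<Otimes>\<^sub>M F T)"
    using assms unfolding progressively_measurable_def by blast
  ultimately have "(\<lambda>p. case (fst p, snd p) of (s, \<omega>) \<Rightarrow> H s \<omega>)
      \<in> borel_measurable (restrict_space borel {0..T} \<Otimes>\<^sub>M M)"
    by (rule measurable_compose)
  then show ?thesis by (simp only: prod.collapse)
qed

text \<open>Up to events of vanishing probability, a large value of \<open>J\<close> with a small
  bracket forces the same for an approximating simple integral. The bracket is taken at the same
  \<open>t\<close> as \<open>J\<close>, so that the bound can be used at a time depending on the
  path.\<close>

lemma ito_integral_maximal:
  fixes H :: "real \<Rightarrow> 'a \<Rightarrow> real^'d^'n::finite"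
  assumes I: "is_ito_integral M F w H J" and \<epsilon>: "0 < \<epsilon>" and \<eta>: "0 < \<eta>"
  defines "Q \<equiv> \<lambda>t \<omega>. \<integral>\<^sup>+s\<in>{0..t}. ennreal ((norm (H s \<omega>))\<^sup>2) \<partial>lborel"
  shows "\<And>t. 0 \<le> t \<Longrightarrow> {\<omega>\<in>space M. \<epsilon> < norm (J t \<omega>) \<and> Q t \<omega> < ennreal \<eta>} \<in> events"
    and "prob (\<Union>t\<in>\<rat> \<inter> {0..}. {\<omega>\<in>space M. \<epsilon> < norm (J t \<omega>) \<and> Q t \<omega> < ennreal \<eta>})
      \<le> 16 * real CARD('d) * \<eta> / \<epsilon>\<^sup>2"
proof -
  have pm: "progressively_measurable F H" using I by (simp add: is_ito_integral_def)
  have J: "J t \<in> borel_measurable M" if "0 \<le> t" for t using I that by (simp add: is_ito_integral_def)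
  obtain k \<tau> \<xi> where sd: "\<And>n. simple_data M F (k n) (\<tau> n) (\<xi> n)"
    and lim_H: "\<And>T. 0 \<le> T \<Longrightarrow> vanishes_in_probability M (\<lambda>n \<omega>. \<integral>\<^sup>+s\<in>{0..T}.
        ennreal ((norm (simple_process (k n) (\<tau> n) (\<xi> n) s \<omega> - H s \<omega>))\<^sup>2) \<partial>lborel) sequentially"
    and lim_J: "\<And>t. 0 \<le> t \<Longrightarrow> vanishes_in_probability M
        (\<lambda>n \<omega>. ennreal (norm (simple_integral w (k n) (\<tau> n) (\<xi> n) t \<omega> - J t \<omega>))) sequentially"
    using I unfolding is_ito_integral_def by blast
  let ?R = "\<lambda>T. restrict_space borel {0..T}"
  let ?P = "\<lambda>n. simple_process (k n) (\<tau> n) (\<xi> n)"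
  let ?S = "\<lambda>n. simple_integral w (k n) (\<tau> n) (\<xi> n)"
  define D where "D n t \<omega> = (\<integral>\<^sup>+s\<in>{0..t}. ennreal ((norm (?P n s \<omega> - H s \<omega>))\<^sup>2) \<partial>lborel)" for n t \<omega>
  define Qn where "Qn n t \<omega> = (\<integral>\<^sup>+s\<in>{0..t}. ennreal ((norm (?P n s \<omega>))\<^sup>2) \<partial>lborel)" for n t \<omega>
  have Hm: "(\<lambda>p. H (fst p) (snd p)) \<in> borel_measurable (?R T \<Otimes>\<^sub>M M)" if "0 \<le> T" for T
    using progressively_measurable_jointly[OF pm that] by (simp add: case_prod_beta)
  have Pm: "(\<lambda>p. ?P n (fst p) (snd p)) \<in> borel_measurable (?R T \<Otimes>\<^sub>M M)" for n T
  proof -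
    have "(\<lambda>p. (fst p, snd p)) \<in> ?R T \<Otimes>\<^sub>M M \<rightarrow>\<^sub>M borel \<Otimes>\<^sub>M M"
      by (intro measurable_Pair measurable_snd measurable_compose[OF measurable_fst] measurable_restrict_space1) simp
    from measurable_compose[OF this simple_process_measurable[OF sd]] show ?thesis
      by (simp add: case_prod_beta)
  qed
  have Qm: "Q t \<in> borel_measurable M" if "0 \<le> t" for t
  proof -
    note [measurable] = Hm[OF that]
    show ?thesis unfolding Q_def
      by (rule nn_integral_interval_measurable) (simp add: case_prod_beta, measurable)
  qed
  have Dm: "D n t \<in> borel_measurable M" if "0 \<le> t" for t n
  proof -
    note [measurable] = Hm[OF that] Pm[of n t]
    show ?thesis unfolding D_def
      by (rule nn_integral_interval_measurable) (simp add: case_prod_beta, measurable)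
  qed
  have QnM: "Qn n t \<in> borel_measurable M" for t n
  proof -
    note [measurable] = Pm[of n t]
    show ?thesis unfolding Qn_def
      by (rule nn_integral_interval_measurable) (simp add: case_prod_beta, measurable)
  qed
  note Sm = simple_integral_measurable[OF sd]
  have Qn_le: "Qn n t \<omega> \<le> 2 * Q t \<omega> + 2 * D n t \<omega>" if t: "0 \<le> t" and \<omega>: "\<omega> \<in> space M" for n t \<omega>
  proof -
    have [measurable]: "(\<lambda>s. H s \<omega>) \<in> borel_measurable (restrict_space lborel {0..t})"
      "(\<lambda>s. ?P n s \<omega>) \<in> borel_measurable (restrict_space lborel {0..t})"
      using measurable_compose[OF measurable_Pair2'[OF \<omega>] Hm[OF t]]
        measurable_compose[OF measurable_Pair2'[OF \<omega>] Pm[of n t]]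
      by (simp_all cong: measurable_cong_sets add: sets_restrict_space_cong[of lborel borel])
    have le: "(norm (?P n s \<omega>))\<^sup>2 \<le> 2 * (norm (H s \<omega>))\<^sup>2 + 2 * (norm (?P n s \<omega> - H s \<omega>))\<^sup>2" for s
    proof -
      have "(norm (?P n s \<omega>))\<^sup>2 \<le> (norm (H s \<omega>) + norm (?P n s \<omega> - H s \<omega>))\<^sup>2"
        using norm_triangle_sub[of "?P n s \<omega>" "H s \<omega>"] by (intro power_mono) auto
      also have "\<dots> \<le> 2 * (norm (H s \<omega>))\<^sup>2 + 2 * (norm (?P n s \<omega> - H s \<omega>))\<^sup>2"
        using sum_squares_bound[of "norm (H s \<omega>)" "norm (?P n s \<omega> - H s \<omega>)"] by (simp add: power2_sum)
      finally show ?thesis .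
    qed
    have "Qn n t \<omega> \<le> (\<integral>\<^sup>+s. 2 * ennreal ((norm (H s \<omega>))\<^sup>2)
        + 2 * ennreal ((norm (?P n s \<omega> - H s \<omega>))\<^sup>2) \<partial>restrict_space lborel {0..t})"
      unfolding Qn_def nn_integral_restrict_space[of "{0..t}" lborel, simplified, symmetric]
    proof (rule nn_integral_mono)
      fix s
      have "ennreal ((norm (?P n s \<omega>))\<^sup>2) \<le> ennreal (2 * (norm (H s \<omega>))\<^sup>2 + 2 * (norm (?P n s \<omega> - H s \<omega>))\<^sup>2)"
        using le by (rule ennreal_leI)
      then show "ennreal ((norm (?P n s \<omega>))\<^sup>2) \<le> 2 * ennreal ((norm (H s \<omega>))\<^sup>2)
          + 2 * ennreal ((norm (?P n s \<omega> - H s \<omega>))\<^sup>2)"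
        by (simp add: ennreal_mult ennreal_plus)
    qed
    also have "\<dots> = 2 * Q t \<omega> + 2 * D n t \<omega>"
      unfolding Q_def D_def nn_integral_restrict_space[of "{0..t}" lborel, simplified, symmetric]
      by (subst nn_integral_add) (simp_all add: nn_integral_cmult)
    finally show ?thesis .
  qed
  define E where "E t = {\<omega>\<in>space M. \<epsilon> < norm (J t \<omega>) \<and> Q t \<omega> < ennreal \<eta>}" for t
  have Em: "E t \<in> events" if "0 \<le> t" for t
  proof -
    note [measurable] = J[OF that] Qm[OF that]
    show ?thesis unfolding E_def by measurable
  qed
  have fin: "prob (\<Union>t\<in>T. E t) \<le> 16 * real CARD('d) * \<eta> / \<epsilon>\<^sup>2" if T: "finite T" "T \<subseteq> \<rat> \<inter> {0..}" for T
  proof -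
    \<comment> \<open>Half of \<open>\<epsilon>\<close> is left for the approximation error of
      \<open>J\<close>. The bracket level \<open>4 * \<eta>\<close> comes from \<open>Qn_le\<close>:
      twice the bracket of \<open>H\<close>, below \<open>\<eta>\<close>, plus twice the squared
      distance, at most \<open>\<eta>\<close> outside \<open>C n t\<close>. Dividing
      \<open>4 * \<eta>\<close> by the square of \<open>\<epsilon> / 2\<close> gives the constant
      16.\<close>
    define A where "A n = {\<omega>\<in>space M. \<exists>t\<in>T. \<epsilon> / 2 < norm (?S n t \<omega>) \<and> Qn n t \<omega> < ennreal (4 * \<eta>)}" for n
    define B where "B n t = {\<omega>\<in>space M. ennreal (\<epsilon> / 2) < ennreal (norm (?S n t \<omega> - J t \<omega>))}" for n t
    define C where "C n t = {\<omega>\<in>space M. ennreal \<eta> < D n t \<omega>}" for n t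
    have t0: "0 \<le> t" if "t \<in> T" for t using T that by auto
    have meas: "A n \<in> events" "t \<in> T \<Longrightarrow> B n t \<in> events" "t \<in> T \<Longrightarrow> C n t \<in> events" for n t
    proof -
      have [measurable]: "?S n t \<in> borel_measurable M" "Qn n t \<in> borel_measurable M"
        "J t \<in> borel_measurable M" "D n t \<in> borel_measurable M" if "t \<in> T" for t
        using Sm QnM J Dm t0[OF that] by auto
      show "A n \<in> events" using T(1) unfolding A_def by measurable
      show "t \<in> T \<Longrightarrow> B n t \<in> events" "t \<in> T \<Longrightarrow> C n t \<in> events"
        unfolding B_def C_def by measurable
    qed
    have sub: "(\<Union>t\<in>T. E t) \<subseteq> A n \<union> ((\<Union>t\<in>T. B n t) \<union> (\<Union>t\<in>T. C n t))" for n
    proof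
      fix \<omega> assume "\<omega> \<in> (\<Union>t\<in>T. E t)"
      then obtain t where t: "t \<in> T" "\<omega> \<in> space M" "\<epsilon> < norm (J t \<omega>)" "Q t \<omega> < ennreal \<eta>"
        by (auto simp: E_def)
      show "\<omega> \<in> A n \<union> ((\<Union>t\<in>T. B n t) \<union> (\<Union>t\<in>T. C n t))"
      proof (rule ccontr)
        assume "\<omega> \<notin> A n \<union> ((\<Union>t\<in>T. B n t) \<union> (\<Union>t\<in>T. C n t))"
        then have nA: "\<not> (\<epsilon> / 2 < norm (?S n t \<omega>) \<and> Qn n t \<omega> < ennreal (4 * \<eta>))"
          and nB: "norm (?S n t \<omega> - J t \<omega>) \<le> \<epsilon> / 2" and nC: "D n t \<omega> \<le> ennreal \<eta>"
          using t \<epsilon> by (auto simp: A_def B_def C_def not_less)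
        have "norm (J t \<omega>) \<le> norm (?S n t \<omega>) + norm (?S n t \<omega> - J t \<omega>)"
          by (metis norm_minus_commute norm_triangle_sub)
        then have "\<epsilon> / 2 < norm (?S n t \<omega>)" using t(3) nB by simp
        moreover have "Qn n t \<omega> < ennreal (4 * \<eta>)"
        proof -
          obtain q where q: "Q t \<omega> = ennreal q" "0 \<le> q" "q < \<eta>"
            using t(4) \<eta> by (cases "Q t \<omega>") (auto simp: ennreal_less_iff)
          have "Qn n t \<omega> \<le> 2 * Q t \<omega> + 2 * D n t \<omega>" by (rule Qn_le[OF t0[OF t(1)] t(2)])
          also have "\<dots> \<le> 2 * Q t \<omega> + 2 * ennreal \<eta>" using nC by (intro add_left_mono mult_left_mono) auto
          also have "\<dots> = ennreal (2 * q + 2 * \<eta>)" using q \<eta> by (simp add: ennreal_mult ennreal_plus)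
          also have "\<dots> < ennreal (4 * \<eta>)" using q \<eta> by (subst ennreal_less_iff) auto
          finally show ?thesis .
        qed
        ultimately show False using nA by simp
      qed
    qed
    have le: "prob (\<Union>t\<in>T. E t) \<le> 16 * real CARD('d) * \<eta> / \<epsilon>\<^sup>2 + ((\<Sum>t\<in>T. prob (B n t)) + (\<Sum>t\<in>T. prob (C n t)))" for n
    proof -
      have U: "(\<Union>t\<in>T. B n t) \<in> events" "(\<Union>t\<in>T. C n t) \<in> events"
        by (intro sets.finite_UN T(1) meas; assumption)+
      have "prob (\<Union>t\<in>T. E t) \<le> prob (A n \<union> ((\<Union>t\<in>T. B n t) \<union> (\<Union>t\<in>T. C n t)))"
        by (intro finite_measure_mono sub sets.Un meas U)
      also have "\<dots> \<le> prob (A n) + prob ((\<Union>t\<in>T. B n t) \<union> (\<Union>t\<in>T. C n t))"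
        by (intro measure_Un_le sets.Un meas U)
      also have "\<dots> \<le> prob (A n) + (prob (\<Union>t\<in>T. B n t) + prob (\<Union>t\<in>T. C n t))"
        by (intro add_left_mono measure_Un_le U)
      also have "\<dots> \<le> prob (A n) + ((\<Sum>t\<in>T. prob (B n t)) + (\<Sum>t\<in>T. prob (C n t)))"
        using meas by (intro add_mono order_refl measure_UNION_le T(1)) blast+
      also have "prob (A n) \<le> real CARD('d) * (4 * \<eta>) / (\<epsilon> / 2)\<^sup>2"
        unfolding A_def Qn_def using T \<epsilon> \<eta> by (intro simple_integral_maximal[OF sd]) auto
      also have "real CARD('d) * (4 * \<eta>) / (\<epsilon> / 2)\<^sup>2 = 16 * real CARD('d) * \<eta> / \<epsilon>\<^sup>2"
        by (simp add: power_divide)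
      finally show ?thesis by simp
    qed
    have lim: "(\<lambda>n. 16 * real CARD('d) * \<eta> / \<epsilon>\<^sup>2 + ((\<Sum>t\<in>T. prob (B n t)) + (\<Sum>t\<in>T. prob (C n t))))
        \<longlonglongrightarrow> 16 * real CARD('d) * \<eta> / \<epsilon>\<^sup>2 + ((\<Sum>t\<in>T. 0) + (\<Sum>t\<in>T. 0))"
    proof (intro tendsto_add tendsto_const tendsto_sum)
      fix t assume t: "t \<in> T"
      show "(\<lambda>n. prob (B n t)) \<longlonglongrightarrow> 0"
        unfolding B_def
        using lim_J[OF t0[OF t], unfolded vanishes_in_probability_def] half_gt_zero[OF \<epsilon>] by auto
      show "(\<lambda>n. prob (C n t)) \<longlonglongrightarrow> 0"
        unfolding C_def D_def
        using lim_H[OF t0[OF t], unfolded vanishes_in_probability_def] \<eta> by auto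
    qed
    show ?thesis using LIMSEQ_le_const[OF lim] le by simp
  qed
  show "{\<omega>\<in>space M. \<epsilon> < norm (J t \<omega>) \<and> Q t \<omega> < ennreal \<eta>} \<in> events" if "0 \<le> t" for t
    using Em[OF that] by (simp add: E_def)
  have "prob (\<Union>t\<in>\<rat> \<inter> {0..}. E t) \<le> 16 * real CARD('d) * \<eta> / \<epsilon>\<^sup>2"
    by (rule measure_countable_UN_le) (use Em fin countable_rat in auto)
  then show "prob (\<Union>t\<in>\<rat> \<inter> {0..}. {\<omega>\<in>space M. \<epsilon> < norm (J t \<omega>) \<and> Q t \<omega> < ennreal \<eta>})
      \<le> 16 * real CARD('d) * \<eta> / \<epsilon>\<^sup>2"
    by (simp add: E_def)
qed

end

section \<open>The process stays large for a short time\<close>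

text \<open>The infimum of the times spent outside the open ball is attained: were the path inside
  the ball at that time, right continuity would keep it inside for a while longer.\<close>

lemma first_exit_time:
  fixes f :: "real \<Rightarrow> 'v::real_normed_vector"
  assumes rc: "\<And>t. 0 \<le> t \<Longrightarrow> (f \<longlongrightarrow> f t) (at_right t)"
    and s: "0 \<le> s" "r \<le> norm (f s - y)"
  obtains \<tau> where "0 \<le> \<tau>" "\<tau> \<le> s" "r \<le> norm (f \<tau> - y)" "\<And>u. 0 \<le> u \<Longrightarrow> u < \<tau> \<Longrightarrow> norm (f u - y) < r"
proof -
  define S where "S = {u. 0 \<le> u \<and> r \<le> norm (f u - y)}"
  have sS: "s \<in> S" using s by (simp add: S_def)
  have bdd: "bdd_below S" unfolding S_def by (auto intro: bdd_belowI[of _ 0])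
  have "0 \<le> Inf S" using sS by (intro cInf_greatest) (auto simp: S_def)
  have min: "norm (f u - y) < r" if "0 \<le> u" "u < Inf S" for u
    using that cInf_lower[OF _ bdd, of u] by (auto simp: S_def not_le[symmetric])
  have "r \<le> norm (f (Inf S) - y)"
  proof (rule ccontr)
    assume "\<not> r \<le> norm (f (Inf S) - y)"
    then have less: "norm (f (Inf S) - y) < r" by simp
    have "((\<lambda>u. norm (f u - y)) \<longlongrightarrow> norm (f (Inf S) - y)) (at_right (Inf S))"
      using rc[OF \<open>0 \<le> Inf S\<close>] by (intro tendsto_intros)
    then have "eventually (\<lambda>u. norm (f u - y) < r) (at_right (Inf S))"
      using less by (rule order_tendstoD)
    then obtain c where c: "Inf S < c" "\<And>u. Inf S < u \<Longrightarrow> u < c \<Longrightarrow> norm (f u - y) < r"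
      by (auto simp: eventually_at_right_field)
    \<comment> \<open>The path is inside the ball at \<open>Inf S\<close> and on the open interval
      up to \<open>c\<close>, so no exit time precedes \<open>c\<close>.\<close>
    have "c \<le> Inf S"
    proof (rule cInf_greatest)
      fix u assume u: "u \<in> S"
      then have "Inf S \<le> u" "r \<le> norm (f u - y)" using bdd by (auto intro: cInf_lower simp: S_def)
      then show "c \<le> u" using c(2)[of u] less by (cases "u = Inf S") (auto intro: leI)
    qed (use sS in auto)
    then show False using c by simp
  qed
  then show ?thesis using that[of "Inf S"] \<open>0 \<le> Inf S\<close> cInf_lower[OF sS bdd] min by blast
qed

text \<open>The pathwise core. Falling below |y|/2 means leaving the ball of radius |y|/2 about
  \<open>y\<close>. Before the exit |f| <= (3/2)|y|, and \<open>6 * K * \<delta> \<le> 1\<close>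
  keeps the drift below |y|/4, so \<open>J\<close> has to supply the other |y|/4. Giving up a factor
  2 both in \<open>J\<close> and in the bracket makes room to move from the exit time to a later
  rational one. The equation is used at the exit time only, so \<open>t\<close> may pass
  \<open>\<delta>\<close>.\<close>

lemma rational_after_exit:
  fixes f :: "real \<Rightarrow> 'v::euclidean_space" and J :: "real \<Rightarrow> 'v" and h :: "real \<Rightarrow> 'u::real_normed_vector"
  assumes rc: "\<And>t. 0 \<le> t \<Longrightarrow> (f \<longlongrightarrow> f t) (at_right t)" and J: "continuous_on {0..} J"
    and K: "0 < K" "\<And>u. 0 \<le> u \<Longrightarrow> norm (\<beta> u) \<le> K * norm (f u)" "\<And>u. 0 \<le> u \<Longrightarrow> norm (h u) \<le> K * norm (f u)"
    and \<beta>: "\<And>t. 0 \<le> t \<Longrightarrow> t \<le> \<delta> \<Longrightarrow> set_integrable lborel {0..t} \<beta>"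
    and eq: "\<And>t. 0 \<le> t \<Longrightarrow> t \<le> \<delta> \<Longrightarrow> f t = y + (LINT u:{0..t}|lborel. \<beta> u) + J t"
    and y: "y \<noteq> 0" and s: "0 \<le> s" "s \<le> \<delta>" "norm (f s) < norm y / 2" and \<delta>: "6 * K * \<delta> \<le> 1" "0 < \<delta>"
  obtains t where "t \<in> \<rat> \<inter> {0..}" "norm y / 8 < norm (J t)"
    "(\<integral>\<^sup>+u\<in>{0..t}. ennreal ((norm (h u))\<^sup>2) \<partial>lborel) < ennreal (9 / 2 * K\<^sup>2 * (norm y)\<^sup>2 * \<delta>)"
proof -
  have "norm y / 2 \<le> norm (f s - y)"
    using norm_triangle_ineq2[of y "f s"] s(3) by (simp add: norm_minus_commute)
  then obtain \<tau> where \<tau>: "0 \<le> \<tau>" "\<tau> \<le> s" "norm y / 2 \<le> norm (f \<tau> - y)"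
    and before: "\<And>u. 0 \<le> u \<Longrightarrow> u < \<tau> \<Longrightarrow> norm (f u - y) < norm y / 2"
    using first_exit_time[OF rc s(1)] by blast
  have \<tau>\<delta>: "\<tau> \<le> \<delta>" using \<tau> s by simp
  have f_le: "norm (f u) \<le> 3 / 2 * norm y" if "0 \<le> u" "u < \<tau>" for u
    using before[OF that] norm_triangle_ineq2[of "f u" y] by simp
  have "norm (LINT u:{0..\<tau>}|lborel. \<beta> u) \<le> (LINT u|lborel. norm (indicator {0..\<tau>} u *\<^sub>R \<beta> u))"
    unfolding set_lebesgue_integral_def by (rule integral_norm_bound)
  also have "\<dots> \<le> (LINT u|lborel. indicator {0..\<tau>} u * (K * (3 / 2 * norm y)))"
  proof (rule integral_mono_AE)
    show "integrable lborel (\<lambda>u. norm (indicator {0..\<tau>} u *\<^sub>R \<beta> u))"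
      using \<beta>[OF \<tau>(1) \<tau>\<delta>] by (intro integrable_norm) (simp add: set_integrable_def)
    show "integrable lborel (\<lambda>u. indicator {0..\<tau>} u * (K * (3 / 2 * norm y)))"
      by (intro integrable_mult_left) (simp add: integrable_indicator_iff emeasure_lborel_Icc_eq)
    have "norm (\<beta> u) \<le> K * (3 / 2 * norm y)" if "0 \<le> u" "u < \<tau>" for u
      using order_trans[OF K(2)[OF that(1)] mult_left_mono[OF f_le[OF that], of K]] K(1) by simp
    then show "AE u in lborel. norm (indicator {0..\<tau>} u *\<^sub>R \<beta> u) \<le> indicator {0..\<tau>} u * (K * (3 / 2 * norm y))"
      by (intro AE_mp[OF AE_lborel_singleton[of \<tau>] AE_I2]) (auto simp: indicator_def)
  qed
  also have "\<dots> = \<tau> * (K * (3 / 2 * norm y))" using \<tau> by simp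
  also have "\<dots> \<le> \<delta> * (K * (3 / 2 * norm y))" using \<tau>\<delta> K by (intro mult_right_mono) auto
  also have "\<dots> = (6 * K * \<delta>) * (norm y / 4)" by simp
  also have "\<dots> \<le> 1 * (norm y / 4)" by (intro mult_right_mono \<delta>) simp
  finally have b_le: "norm (LINT u:{0..\<tau>}|lborel. \<beta> u) \<le> norm y / 4" by simp
  have "norm (f \<tau> - y) \<le> norm (LINT u:{0..\<tau>}|lborel. \<beta> u) + norm (J \<tau>)"
    using eq[OF \<tau>(1) \<tau>\<delta>] norm_triangle_ineq[of "LINT u:{0..\<tau>}|lborel. \<beta> u" "J \<tau>"] by simp
  then have "norm y / 4 \<le> norm (J \<tau>)" using b_le \<tau>(3) by simp
  moreover have "0 < norm y" using y by simp
  ultimately have J\<tau>: "norm y / 8 < norm (J \<tau>)" by linarith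
  have "(J \<longlongrightarrow> J \<tau>) (at \<tau> within {0..})" using J \<tau> by (auto simp: continuous_on_def)
  then have "(J \<longlongrightarrow> J \<tau>) (at_right \<tau>)" by (rule tendsto_within_subset) (use \<tau> in auto)
  then have "eventually (\<lambda>u. norm y / 8 < norm (J u)) (at_right \<tau>)"
    using J\<tau> by (intro order_tendstoD(1)[OF tendsto_norm])
  moreover have "eventually (\<lambda>u. norm (f u) < norm (f \<tau>) + 1) (at_right \<tau>)"
    using rc[OF \<tau>(1)] by (intro order_tendstoD(2)[OF tendsto_norm]) auto
  ultimately have "eventually (\<lambda>u. norm y / 8 < norm (J u) \<and> norm (f u) < norm (f \<tau>) + 1) (at_right \<tau>)"
    by (rule eventually_conj)
  then obtain c where c: "\<tau> < c" "\<And>u. \<tau> < u \<Longrightarrow> u < c \<Longrightarrow> norm y / 8 < norm (J u) \<and> norm (f u) < norm (f \<tau>) + 1"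
    by (auto simp: eventually_at_right_field)
  \<comment> \<open>\<open>\<eta>\<close> is the square of (3/2) K |y| and bounds the integrand
    before the exit; the bracket then gathers at most \<open>\<eta> * \<delta>\<close>, half of what
    is allowed.\<close>
  define \<eta> where "\<eta> = 9 / 4 * K\<^sup>2 * (norm y)\<^sup>2"
  \<comment> \<open>Just after the exit right continuity bounds |f| by its value at
    \<open>\<tau>\<close> plus 1. Staying within \<open>\<eta> * \<delta> / \<kappa>\<close> of
    \<open>\<tau>\<close> spends less than the other half of the allowance.\<close>
  define \<kappa> where "\<kappa> = (K * (norm (f \<tau>) + 1))\<^sup>2"
  have \<eta>: "0 < \<eta>" using K y by (simp add: \<eta>_def)
  have \<kappa>: "0 < \<kappa>" using K norm_ge_zero[of "f \<tau>"] by (simp add: \<kappa>_def add_nonneg_pos del: norm_ge_zero)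
  have "\<tau> < min c (\<tau> + \<eta> * \<delta> / \<kappa>)" using c \<eta> \<kappa> \<delta> by simp
  then obtain t where t: "t \<in> \<rat>" "\<tau> < t" "t < c" "t < \<tau> + \<eta> * \<delta> / \<kappa>"
    using Rats_dense_in_real by (metis min_less_iff_conj)
  have h1: "(norm (h u))\<^sup>2 \<le> \<eta>" if "0 \<le> u" "u < \<tau>" for u
  proof -
    have "norm (h u) \<le> K * (3 / 2 * norm y)"
      using order_trans[OF K(3)[OF that(1)] mult_left_mono[OF f_le[OF that], of K]] K(1) by simp
    then have "(norm (h u))\<^sup>2 \<le> (K * (3 / 2 * norm y))\<^sup>2" by (intro power_mono) auto
    then show ?thesis by (simp add: \<eta>_def power2_eq_square algebra_simps)
  qed
  have h2: "(norm (h u))\<^sup>2 \<le> \<kappa>" if "\<tau> \<le> u" "u \<le> t" for u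
  proof -
    have fu: "norm (f u) \<le> norm (f \<tau>) + 1" using c(2)[of u] that t by (cases "u = \<tau>") auto
    have "0 \<le> u" using that \<tau> by simp
    then have "norm (h u) \<le> K * (norm (f \<tau>) + 1)"
      using order_trans[OF K(3) mult_left_mono[OF fu, of K]] K(1) by simp
    then show ?thesis unfolding \<kappa>_def by (intro power_mono) auto
  qed
  have "(\<integral>\<^sup>+u\<in>{0..t}. ennreal ((norm (h u))\<^sup>2) \<partial>lborel)
      \<le> (\<integral>\<^sup>+u. ennreal \<eta> * indicator {0..\<tau>} u + ennreal \<kappa> * indicator {\<tau>..t} u \<partial>lborel)"
  proof (rule nn_integral_mono)
    fix u
    show "ennreal ((norm (h u))\<^sup>2) * indicator {0..t} u
        \<le> ennreal \<eta> * indicator {0..\<tau>} u + ennreal \<kappa> * indicator {\<tau>..t} u"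
      using h1[of u] h2[of u] by (cases "u < \<tau>") (auto simp: indicator_def ennreal_leI intro: add_increasing)
  qed
  also have "\<dots> = ennreal (\<eta> * \<tau> + \<kappa> * (t - \<tau>))"
    using \<tau> t \<eta> \<kappa> by (subst nn_integral_add) (auto simp: nn_integral_cmult ennreal_mult)
  also have "\<dots> < ennreal (9 / 2 * K\<^sup>2 * (norm y)\<^sup>2 * \<delta>)"
  proof -
    have "\<kappa> * (t - \<tau>) < \<eta> * \<delta>" using t(4) \<kappa> by (simp add: field_simps)
    moreover have "\<eta> * \<tau> \<le> \<eta> * \<delta>" using \<tau>\<delta> \<eta> by simp
    ultimately have "\<eta> * \<tau> + \<kappa> * (t - \<tau>) < 9 / 2 * K\<^sup>2 * (norm y)\<^sup>2 * \<delta>" by (simp add: \<eta>_def)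
    moreover have "0 \<le> \<eta> * \<tau> + \<kappa> * (t - \<tau>)" using \<eta> \<kappa> \<tau> t by simp
    ultimately show ?thesis by (simp only: ennreal_less_iff)
  qed
  finally show ?thesis using that[of t] t c \<tau> by simp
qed

context driving_noise
begin

text \<open>The strip has intensity \<open>lam * t\<close>, so it contains no point with probability
  exp(- lam t) >= 1 - lam t.\<close>

lemma jump_free_strip:
  assumes t: "0 \<le> t"
  shows "{0<..t} \<times> \<Gamma> \<in> sets (restrict_space lborel {0..} \<Otimes>\<^sub>M scale_measure (ennreal lam) \<pi>)"
    and "prob {\<omega>\<in>space M. emeasure (N \<omega>) ({0<..t} \<times> \<Gamma>) \<noteq> 0} \<le> lam * t"
    and "{\<omega>\<in>space M. emeasure (N \<omega>) ({0<..t} \<times> \<Gamma>) \<noteq> 0} \<in> events"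
proof -
  let ?\<mu> = "restrict_space lborel {0..} \<Otimes>\<^sub>M scale_measure (ennreal lam) \<pi>"
  let ?A = "{0<..t} \<times> \<Gamma>"
  interpret P: prob_space \<pi> by (rule prob_space_jumps)
  have "\<Gamma> = space \<pi>"
    using sets_eq_imp_space_eq[OF sets_jumps] by (simp add: space_restrict_space)
  then have \<Gamma>: "\<Gamma> \<in> sets (scale_measure (ennreal lam) \<pi>)" by simp
  have I: "{0<..t} \<in> sets (restrict_space lborel {0..})"
    by (auto simp: sets_restrict_space image_iff intro!: bexI[of _ "{0<..t}"])
  show A: "?A \<in> sets ?\<mu>" using I \<Gamma> by simp
  interpret S: finite_measure "scale_measure (ennreal lam) \<pi>"
    by (rule finite_measureI) (simp add: ennreal_mult_eq_top_iff)
  have em_I: "emeasure (restrict_space lborel {0..}) {0<..t} = ennreal t"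
    using t by (subst emeasure_restrict_space) auto
  have em: "emeasure ?\<mu> ?A = ennreal (lam * t)"
    using t lam_pos \<open>\<Gamma> = space \<pi>\<close>
    by (subst S.emeasure_pair_measure_Times[OF I \<Gamma>])
      (simp add: em_I P.emeasure_space_1 ennreal_mult mult.commute)
  have cnt: "prob {\<omega>\<in>space M. emeasure (N \<omega>) ?A = of_nat n} = exp (- measure ?\<mu> ?A) * measure ?\<mu> ?A ^ n / fact n" for n
    using poisson[unfolded poisson_random_measure_def, THEN conjunct2, THEN conjunct2, THEN conjunct1,
        rule_format, OF A] by (simp only: em ennreal_less_top infinity_ennreal_def)
  have [measurable]: "(\<lambda>\<omega>. emeasure (N \<omega>) ?A) \<in> borel_measurable M"
    using poisson A unfolding poisson_random_measure_def by blast
  show "{\<omega>\<in>space M. emeasure (N \<omega>) ?A \<noteq> 0} \<in> events" by measurable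
  have "prob {\<omega>\<in>space M. emeasure (N \<omega>) ?A \<noteq> 0} = 1 - prob {\<omega>\<in>space M. emeasure (N \<omega>) ?A = 0}"
    by (rule prob_neg) measurable
  also have "\<dots> = 1 - exp (- (lam * t))"
    using cnt[of 0] em t lam_pos by (simp add: measure_def)
  also have "\<dots> \<le> lam * t" using exp_ge_add_one_self[of "- (lam * t)"] by simp
  finally show "prob {\<omega>\<in>space M. emeasure (N \<omega>) ?A \<noteq> 0} \<le> lam * t" .
qed

end

section \<open>The filtration generated by the process\<close>

lemma history_sets:
  "sets (history M X \<alpha> t) = sigma_sets (space M)
     {(\<lambda>\<omega>. (X s \<omega>, \<alpha> s \<omega>)) -` B \<inter> space M | s B. s \<in> {0..t} \<and> B \<in> sets (borel \<Otimes>\<^sub>M count_space UNIV)}"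
  unfolding history_def generated_sigma_def by (rule sets_measure_of) auto

lemma history_space: "space (history M X \<alpha> t) = space M"
  unfolding history_def generated_sigma_def by (rule space_measure_of) auto

lemma history_subalgebra:
  fixes X :: "real \<Rightarrow> 'a \<Rightarrow> 'b::topological_space"
  assumes "\<And>s. 0 \<le> s \<Longrightarrow> s \<le> t \<Longrightarrow> X s \<in> borel_measurable M"
    and "\<And>s. 0 \<le> s \<Longrightarrow> s \<le> t \<Longrightarrow> \<alpha> s \<in> M \<rightarrow>\<^sub>M count_space UNIV"
  shows "subalgebra M (history M X \<alpha> t)"
proof -
  have "(\<lambda>\<omega>. (X s \<omega>, \<alpha> s \<omega>)) -` B \<inter> space M \<in> sets M"
    if "s \<in> {0..t}" "B \<in> sets (borel \<Otimes>\<^sub>M count_space UNIV)" for s B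
    using that assms by (intro measurable_sets[OF measurable_Pair]) auto
  then have "sets (history M X \<alpha> t) \<subseteq> sets M"
    unfolding history_sets by (intro sets.sigma_sets_subset) blast
  then show ?thesis by (simp add: subalgebra_def history_space)
qed

lemma history_measurable:
  fixes X :: "real \<Rightarrow> 'a \<Rightarrow> 'b::topological_space"
  assumes "0 \<le> s" "s \<le> t"
  shows "X s \<in> borel_measurable (history M X \<alpha> t)"
proof -
  have "(\<lambda>\<omega>. (X s \<omega>, \<alpha> s \<omega>)) \<in> history M X \<alpha> t \<rightarrow>\<^sub>M borel \<Otimes>\<^sub>M count_space UNIV"
  proof (rule measurableI)
    fix B assume "B \<in> sets (borel \<Otimes>\<^sub>M count_space UNIV :: ('b \<times> nat) measure)"
    then show "(\<lambda>\<omega>. (X s \<omega>, \<alpha> s \<omega>)) -` B \<inter> space (history M X \<alpha> t) \<in> sets (history M X \<alpha> t)"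
      unfolding history_sets history_space using assms by (intro sigma_sets.Basic) auto
  qed (simp add: space_pair_measure)
  from measurable_compose[OF this measurable_fst] show ?thesis by simp
qed

context regime_switching_jump_diffusion
begin

lemma X_measurable: "a \<in> {1..m} \<Longrightarrow> 0 \<le> t \<Longrightarrow> X x a t \<in> borel_measurable M"
  using X_adapted measurable_F_imp_M by blast

lemma \<alpha>_measurable: "a \<in> {1..m} \<Longrightarrow> 0 \<le> t \<Longrightarrow> \<alpha> x a t \<in> M \<rightarrow>\<^sub>M count_space UNIV"
  using alpha_adapted measurable_F_imp_M by blast

text \<open>Without a jump, a path that falls below |y|/2 must produce a large Ito integral with a
  small bracket at some rational time. The last two conditions on \<open>\<delta>\<close> give each
  of the two exceptional events probability at most 1/4.\<close>

lemma stays_large: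
  assumes K: "0 < K"
    and growth: "\<And>x i. i \<in> {1..m} \<Longrightarrow> norm (b x i) \<le> K * norm x"
      "\<And>x i. i \<in> {1..m} \<Longrightarrow> norm (\<sigma> x i) \<le> K * norm x"
    and \<delta>: "0 < \<delta>" "6 * K * \<delta> \<le> 1" "lam * \<delta> \<le> 1 / 4" "4608 * real CARD('d) * K\<^sup>2 * \<delta> \<le> 1 / 4"
    and a: "a \<in> {1..m}" and s: "0 \<le> s" "s \<le> \<delta>"
  shows "1 / 2 \<le> prob {\<omega>\<in>space M. norm y / 2 \<le> norm (X y a s \<omega>)}"
proof (cases "y = 0")
  case True
  then show ?thesis by (simp add: prob_space)
next
  case y: False
  obtain J where I: "is_ito_integral M F w (\<lambda>s \<omega>. \<sigma> (X y a s \<omega>) (\<alpha> y a s \<omega>)) J"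
    and eq: "AE \<omega> in M. \<forall>t\<ge>0.
          set_integrable lborel {0..t} (\<lambda>s. b (X y a s \<omega>) (\<alpha> y a s \<omega>)) \<and>
          set_integrable (N \<omega>) ({0<..t} \<times> \<Gamma>)
            (\<lambda>(s, \<gamma>). g (left_limit (\<lambda>u. X y a u \<omega>) s) (left_limit (\<lambda>u. \<alpha> y a u \<omega>) s) \<gamma>) \<and>
          X y a t \<omega> = y + (LINT s:{0..t}|lborel. b (X y a s \<omega>) (\<alpha> y a s \<omega>)) + J t \<omega>
            + (LINT (s, \<gamma>):{0<..t} \<times> \<Gamma>|N \<omega>.
                 g (left_limit (\<lambda>u. X y a u \<omega>) s) (left_limit (\<lambda>u. \<alpha> y a u \<omega>) s) \<gamma>)"
    using sde[OF a, of y] unfolding solves_sde_def by blast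
  have Jc: "continuous_on {0..} (\<lambda>t. J t \<omega>)" if "\<omega> \<in> space M" for \<omega>
    using I that by (simp add: is_ito_integral_def)
  \<comment> \<open>The bracket level of \<open>rational_after_exit\<close>; its threshold |y|/8 is
    the level for \<open>J\<close> in \<open>E\<close>.\<close>
  define \<eta> where "\<eta> = 9 / 2 * K\<^sup>2 * (norm y)\<^sup>2 * \<delta>"
  define E where "E t = {\<omega>\<in>space M. norm y / 8 < norm (J t \<omega>) \<and>
      (\<integral>\<^sup>+u\<in>{0..t}. ennreal ((norm (\<sigma> (X y a u \<omega>) (\<alpha> y a u \<omega>)))\<^sup>2) \<partial>lborel) < ennreal \<eta>}" for t
  define U where "U = {\<omega>\<in>space M. emeasure (N \<omega>) ({0<..\<delta>} \<times> \<Gamma>) \<noteq> 0}"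
  have pos: "0 < norm y / 8" "0 < \<eta>" using y K \<delta> by (simp_all add: \<eta>_def)
  note ito = ito_integral_maximal[OF I pos, folded E_def]
  note jump = jump_free_strip[OF less_imp_le[OF \<delta>(1)], folded U_def]
  have E_events: "(\<Union>t\<in>\<rat> \<inter> {0..}. E t) \<in> events"
    using ito(1) countable_rat by (intro sets.countable_UN') auto
  have [measurable]: "X y a s \<in> borel_measurable M" using X_measurable a s by simp
  have "prob {\<omega>\<in>space M. norm (X y a s \<omega>) < norm y / 2} \<le> prob (U \<union> (\<Union>t\<in>\<rat> \<inter> {0..}. E t))"
  proof (rule finite_measure_mono_AE)
    show "U \<union> (\<Union>t\<in>\<rat> \<inter> {0..}. E t) \<in> events" using jump(3) E_events by blast
    show "AE \<omega> in M. \<omega> \<in> {\<omega>\<in>space M. norm (X y a s \<omega>) < norm y / 2} \<longrightarrow> \<omega> \<in> U \<union> (\<Union>t\<in>\<rat> \<inter> {0..}. E t)"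
      using eq
    proof (eventually_elim, intro impI)
      fix \<omega> assume *: "\<forall>t\<ge>0.
          set_integrable lborel {0..t} (\<lambda>s. b (X y a s \<omega>) (\<alpha> y a s \<omega>)) \<and>
          set_integrable (N \<omega>) ({0<..t} \<times> \<Gamma>)
            (\<lambda>(s, \<gamma>). g (left_limit (\<lambda>u. X y a u \<omega>) s) (left_limit (\<lambda>u. \<alpha> y a u \<omega>) s) \<gamma>) \<and>
          X y a t \<omega> = y + (LINT s:{0..t}|lborel. b (X y a s \<omega>) (\<alpha> y a s \<omega>)) + J t \<omega>
            + (LINT (s, \<gamma>):{0<..t} \<times> \<Gamma>|N \<omega>.
                 g (left_limit (\<lambda>u. X y a u \<omega>) s) (left_limit (\<lambda>u. \<alpha> y a u \<omega>) s) \<gamma>)"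
        and "\<omega> \<in> {\<omega>\<in>space M. norm (X y a s \<omega>) < norm y / 2}"
      then have \<omega>: "\<omega> \<in> space M" "norm (X y a s \<omega>) < norm y / 2" by auto
      show "\<omega> \<in> U \<union> (\<Union>t\<in>\<rat> \<inter> {0..}. E t)"
      proof (cases "\<omega> \<in> U")
        case False
        then have "emeasure (N \<omega>) ({0<..\<delta>} \<times> \<Gamma>) = 0" using \<omega> by (simp add: U_def)
        moreover have sN: "sets (N \<omega>) = sets (restrict_space lborel {0..} \<Otimes>\<^sub>M scale_measure (ennreal lam) \<pi>)"
          using poisson \<omega>(1) by (simp add: poisson_random_measure_def)
        ultimately have null: "{0<..\<delta>} \<times> \<Gamma> \<in> null_sets (N \<omega>)"
          using jump(1) by (intro null_setsI) simp_all
        \<comment> \<open>Off \<open>U\<close> the measure \<open>N \<omega>\<close> does not charge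
          the strip, so the equation reduces to drift and Ito integral up to time
          \<open>\<delta>\<close>.\<close>
        have jumps0: "(LINT (s, \<gamma>):{0<..t} \<times> \<Gamma>|N \<omega>.
            g (left_limit (\<lambda>u. X y a u \<omega>) s) (left_limit (\<lambda>u. \<alpha> y a u \<omega>) s) \<gamma>) = 0" if "t \<le> \<delta>" for t
          unfolding set_lebesgue_integral_def
        proof (rule integral_eq_zero_AE)
          show "AE p in N \<omega>. indicator ({0<..t} \<times> \<Gamma>) p *\<^sub>R (case p of (s, \<gamma>) \<Rightarrow>
              g (left_limit (\<lambda>u. X y a u \<omega>) s) (left_limit (\<lambda>u. \<alpha> y a u \<omega>) s) \<gamma>) = 0"
            using AE_not_in[OF null] by eventually_elim (use that in \<open>auto simp: indicator_def\<close>)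
        qed
        have \<alpha>: "\<alpha> y a u \<omega> \<in> {1..m}" if "0 \<le> u" for u
          using alpha_range[OF a that \<omega>(1)] .
        obtain t where "t \<in> \<rat> \<inter> {0..}" "norm y / 8 < norm (J t \<omega>)"
          "(\<integral>\<^sup>+u\<in>{0..t}. ennreal ((norm (\<sigma> (X y a u \<omega>) (\<alpha> y a u \<omega>)))\<^sup>2) \<partial>lborel)
            < ennreal (9 / 2 * K\<^sup>2 * (norm y)\<^sup>2 * \<delta>)"
        proof (rule rational_after_exit[where f="\<lambda>t. X y a t \<omega>" and J="\<lambda>t. J t \<omega>"
              and \<beta>="\<lambda>t. b (X y a t \<omega>) (\<alpha> y a t \<omega>)" and h="\<lambda>t. \<sigma> (X y a t \<omega>) (\<alpha> y a t \<omega>)"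
              and K=K and y=y and s=s and \<delta>=\<delta>])
          show "((\<lambda>t. X y a t \<omega>) \<longlongrightarrow> X y a t \<omega>) (at_right t)" if "0 \<le> t" for t
            using X_cadlag[OF a \<omega>(1)] that by (simp add: cadlag_def)
          show "set_integrable lborel {0..t} (\<lambda>t. b (X y a t \<omega>) (\<alpha> y a t \<omega>))" if "0 \<le> t" "t \<le> \<delta>" for t
            using * that by blast
          show "X y a t \<omega> = y + (LINT u:{0..t}|lborel. b (X y a u \<omega>) (\<alpha> y a u \<omega>)) + J t \<omega>"
            if "0 \<le> t" "t \<le> \<delta>" for t
            using * that jumps0[OF that(2)] by simp
        qed (use Jc[OF \<omega>(1)] K growth \<alpha> y s \<omega> \<delta> in auto)
        then have "\<omega> \<in> (\<Union>t\<in>\<rat> \<inter> {0..}. E t)"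
          using \<omega>(1) unfolding E_def \<eta>_def by blast
        then show ?thesis by simp
      qed simp
    qed
  qed
  also have "\<dots> \<le> prob U + prob (\<Union>t\<in>\<rat> \<inter> {0..}. E t)"
    using jump(3) E_events by (rule measure_Un_le)
  also have "\<dots> \<le> lam * \<delta> + 16 * real CARD('d) * \<eta> / (norm y / 8)\<^sup>2"
    by (intro add_mono jump(2) ito(2))
  \<comment> \<open>16 * 64 * 9/2 = 4608; the square of |y| cancels, which is why
    \<open>\<delta>\<close> can be chosen independently of the starting point.\<close>
  also have "16 * real CARD('d) * \<eta> / (norm y / 8)\<^sup>2 = 4608 * real CARD('d) * K\<^sup>2 * \<delta>"
    using y by (simp add: \<eta>_def power2_eq_square field_simps)
  also have "lam * \<delta> + 4608 * real CARD('d) * K\<^sup>2 * \<delta> \<le> 1 / 2"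
    using \<delta> by simp
  finally have "prob {\<omega>\<in>space M. norm (X y a s \<omega>) < norm y / 2} \<le> 1 / 2" .
  moreover have "prob {\<omega>\<in>space M. \<not> norm (X y a s \<omega>) < norm y / 2}
      = 1 - prob {\<omega>\<in>space M. norm (X y a s \<omega>) < norm y / 2}"
    by (rule prob_neg) measurable
  ultimately show ?thesis by (simp add: not_less)
qed

section \<open>Ottaviani's inequality and almost sure stability\<close>

text \<open>Decompose by the first time in \<open>T\<close> at which the threshold is exceeded. From
  the state reached there, the path is still above half the threshold at \<open>T1\<close> with
  conditional probability at least 1/2. The assumption \<open>large\<close> has to be uniform in
  \<open>y\<close> and \<open>c\<close> because that state is random.\<close>

lemma ottaviani_finite:
  assumes large: "\<And>y c u. c \<in> {1..m} \<Longrightarrow> 0 \<le> u \<Longrightarrow> u \<le> \<delta> \<Longrightarrow>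
      1 / 2 \<le> prob {\<omega>\<in>space M. norm y / 2 \<le> norm (X y c u \<omega>)}"
    and a: "a \<in> {1..m}" and T: "finite T" "\<And>t. t \<in> T \<Longrightarrow> 0 \<le> t \<and> t \<le> T1 \<and> T1 \<le> t + \<delta>"
    and T1: "0 \<le> T1"
  shows "prob (\<Union>t\<in>T. {\<omega>\<in>space M. \<rho> < norm (X x a t \<omega>)})
    \<le> 2 * prob {\<omega>\<in>space M. \<rho> / 2 \<le> norm (X x a T1 \<omega>)}"
proof -
  \<comment> \<open>The condition at earlier times makes these events disjoint, so their
    probabilities add up.\<close>
  define E where "E t = {\<omega>\<in>space M. \<rho> < norm (X x a t \<omega>) \<and> (\<forall>r\<in>T \<inter> {..<t}. norm (X x a r \<omega>) \<le> \<rho>)}" for t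
  define B where "B = {\<omega>\<in>space M. \<rho> / 2 \<le> norm (X x a T1 \<omega>)}"
  have [measurable]: "X x a T1 \<in> borel_measurable M" using X_measurable a T1 by blast
  have B[measurable]: "B \<in> events" unfolding B_def by measurable
  \<comment> \<open>The Markov property is formulated with the history of the process rather than
    with \<open>F\<close>, so \<open>E t\<close> must be decided by the path itself up to time
    \<open>t\<close>.\<close>
  have E_history: "E t \<in> sets (history M (X x a) (\<alpha> x a) t)" if t: "t \<in> T" for t
  proof -
    have [measurable]: "Measurable.pred (history M (X x a) (\<alpha> x a) t) (\<lambda>\<omega>. \<forall>r\<in>T \<inter> {..<t}. norm (X x a r \<omega>) \<le> \<rho>)"
    proof (rule pred_intros_finite)
      fix r assume r: "r \<in> T \<inter> {..<t}"
      have [measurable]: "X x a r \<in> borel_measurable (history M (X x a) (\<alpha> x a) t)"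
        using T(2)[of r] r by (intro history_measurable) auto
      show "Measurable.pred (history M (X x a) (\<alpha> x a) t) (\<lambda>\<omega>. norm (X x a r \<omega>) \<le> \<rho>)" by measurable
    qed (use T(1) in auto)
    have [measurable]: "X x a t \<in> borel_measurable (history M (X x a) (\<alpha> x a) t)"
      using T(2)[OF t] by (intro history_measurable) auto
    have "E t = {\<omega>\<in>space (history M (X x a) (\<alpha> x a) t).
        \<rho> < norm (X x a t \<omega>) \<and> (\<forall>r\<in>T \<inter> {..<t}. norm (X x a r \<omega>) \<le> \<rho>)}"
      by (simp add: E_def history_space)
    also have "\<dots> \<in> sets (history M (X x a) (\<alpha> x a) t)" by measurable
    finally show ?thesis .
  qed
  have sub: "subalgebra M (history M (X x a) (\<alpha> x a) t)" for t
    using X_measurable[OF a] \<alpha>_measurable[OF a] by (intro history_subalgebra) auto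
  have E_events: "E t \<in> events" if "t \<in> T" for t
    using E_history[OF that] sub[of t] by (auto simp: subalgebra_def)
  have half: "prob (E t) \<le> 2 * prob (E t \<inter> B)" if t: "t \<in> T" for t
  proof -
    let ?H = "history M (X x a) (\<alpha> x a) t"
    interpret H: finite_measure_subalgebra M ?H
      using sub by unfold_locales
    let ?A = "{z. \<rho> / 2 \<le> norm z} \<times> (UNIV :: nat set)"
    have "?A \<in> sets (borel \<Otimes>\<^sub>M count_space UNIV)" by (intro pair_measureI) auto
    moreover have "0 \<le> t" "0 \<le> T1 - t" "T1 - t \<le> \<delta>" using T(2)[OF t] by auto
    ultimately have "AE \<omega> in M. real_cond_exp M ?H
          (indicator {\<omega>'\<in>space M. (X x a (t + (T1 - t)) \<omega>', \<alpha> x a (t + (T1 - t)) \<omega>') \<in> ?A}) \<omega> =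
        prob {\<omega>'\<in>space M. (X (X x a t \<omega>) (\<alpha> x a t \<omega>) (T1 - t) \<omega>', \<alpha> (X x a t \<omega>) (\<alpha> x a t \<omega>) (T1 - t) \<omega>') \<in> ?A}"
      using markov a unfolding markov_family_def by blast
    then have cond: "AE \<omega> in M. real_cond_exp M ?H (indicator B) \<omega> =
        prob {\<omega>'\<in>space M. \<rho> / 2 \<le> norm (X (X x a t \<omega>) (\<alpha> x a t \<omega>) (T1 - t) \<omega>')}"
      by (simp add: B_def)
    \<comment> \<open>On \<open>E t\<close> the current position has norm above
      \<open>\<rho>\<close>, so staying above half of that norm implies staying above
      \<open>\<rho> / 2\<close>.\<close>
    have ge: "AE \<omega> in M. indicator (E t) \<omega> * (1 / 2) \<le> indicator (E t) \<omega> * real_cond_exp M ?H (indicator B) \<omega>"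
      using cond
    proof (eventually_elim)
      fix \<omega> assume eq: "real_cond_exp M ?H (indicator B) \<omega> =
        prob {\<omega>'\<in>space M. \<rho> / 2 \<le> norm (X (X x a t \<omega>) (\<alpha> x a t \<omega>) (T1 - t) \<omega>')}"
      show "indicator (E t) \<omega> * (1 / 2) \<le> indicator (E t) \<omega> * real_cond_exp M ?H (indicator B) \<omega>"
      proof (cases "\<omega> \<in> E t")
        case True
        let ?y = "X x a t \<omega>" and ?c = "\<alpha> x a t \<omega>"
        have c: "?c \<in> {1..m}" using True alpha_range[OF a \<open>0 \<le> t\<close>] by (auto simp: E_def)
        have [measurable]: "X ?y ?c (T1 - t) \<in> borel_measurable M"
          using X_measurable[OF c \<open>0 \<le> T1 - t\<close>] .
        have "1 / 2 \<le> prob {\<omega>'\<in>space M. norm ?y / 2 \<le> norm (X ?y ?c (T1 - t) \<omega>')}"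
          by (rule large[OF c \<open>0 \<le> T1 - t\<close> \<open>T1 - t \<le> \<delta>\<close>])
        also have "\<dots> \<le> prob {\<omega>'\<in>space M. \<rho> / 2 \<le> norm (X ?y ?c (T1 - t) \<omega>')}"
          using True by (intro finite_measure_mono) (auto simp: E_def)
        finally show ?thesis using True eq by simp
      qed simp
    qed
    have iB: "integrable M (indicator B :: 'a \<Rightarrow> real)"
      by (simp add: integrable_indicator_iff emeasure_eq_measure)
    have "prob (E t) * (1 / 2) = (LINT \<omega>|M. indicator (E t) \<omega> * (1 / 2))"
      using E_events[OF t] by simp
    also have "\<dots> \<le> (LINT \<omega>|M. indicator (E t) \<omega> * real_cond_exp M ?H (indicator B) \<omega>)"
      using integrable_mult_indicator[OF E_events[OF t] H.real_cond_exp_int(1)[OF iB]]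
        integrable_mult_indicator[OF E_events[OF t], of "\<lambda>_. 1 / 2 :: real"]
      by (intro integral_mono_AE ge) auto
    also have "\<dots> = (LINT \<omega>:E t|M. indicator B \<omega>)"
      using H.real_cond_exp_intA[OF iB E_history[OF t]] by (simp add: set_lebesgue_integral_def)
    also have "\<dots> = prob (E t \<inter> B)"
      using E_events[OF t] B
      by (simp add: set_lebesgue_integral_def indicator_inter_arith[symmetric] sets.Int)
    finally show ?thesis by simp
  qed
  have disj: "disjoint_family_on E T"
  proof (unfold disjoint_family_on_def, intro ballI impI)
    fix r t assume "r \<in> T" "t \<in> T" "r \<noteq> t"
    moreover have "E u \<inter> E v = {}" if "u \<in> T" "u < v" for u v
      using that by (auto simp: E_def not_le dest!: bspec[where x=u])
    ultimately show "E r \<inter> E t = {}" by (metis Int_commute linorder_neq_iff)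
  qed
  have "(\<Union>t\<in>T. {\<omega>\<in>space M. \<rho> < norm (X x a t \<omega>)}) \<subseteq> (\<Union>t\<in>T. E t)"
  proof
    fix \<omega> assume "\<omega> \<in> (\<Union>t\<in>T. {\<omega>\<in>space M. \<rho> < norm (X x a t \<omega>)})"
    then have \<omega>: "\<omega> \<in> space M" and ne: "{t \<in> T. \<rho> < norm (X x a t \<omega>)} \<noteq> {}" by auto
    let ?t = "Min {t \<in> T. \<rho> < norm (X x a t \<omega>)}"
    have fin: "finite {t \<in> T. \<rho> < norm (X x a t \<omega>)}" using T(1) by simp
    have t: "?t \<in> T" "\<rho> < norm (X x a ?t \<omega>)" using Min_in[OF fin ne] by auto
    have "norm (X x a r \<omega>) \<le> \<rho>" if "r \<in> T" "r < ?t" for r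
      using Min_le[OF fin, of r] that by (force simp: not_less[symmetric])
    then have "\<omega> \<in> E ?t" using \<omega> t by (auto simp: E_def)
    then show "\<omega> \<in> (\<Union>t\<in>T. E t)" using t by blast
  qed
  then have "prob (\<Union>t\<in>T. {\<omega>\<in>space M. \<rho> < norm (X x a t \<omega>)}) \<le> prob (\<Union>t\<in>T. E t)"
    using E_events T(1) by (intro finite_measure_mono) auto
  also have "\<dots> = (\<Sum>t\<in>T. prob (E t))"
    using E_events T(1) disj by (intro finite_measure_finite_Union) auto
  also have "\<dots> \<le> (\<Sum>t\<in>T. 2 * prob (E t \<inter> B))" by (intro sum_mono half)
  also have "\<dots> = 2 * prob (\<Union>t\<in>T. E t \<inter> B)"
    unfolding sum_distrib_left[symmetric] using E_events T(1) disj B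
    by (subst finite_measure_finite_Union) (auto simp: disjoint_family_on_def)
  also have "\<dots> \<le> 2 * prob B"
    by (intro mult_left_mono finite_measure_mono) auto
  finally show ?thesis by (simp add: B_def)
qed

end

section \<open>From the moment decay to almost sure decay\<close>

lemma (in prob_space) prob_norm_ge_le_moment:
  fixes Y :: "'a \<Rightarrow> 'b::{real_normed_vector,second_countable_topology}"
  assumes [measurable]: "Y \<in> borel_measurable M" and c: "0 < c" and p: "0 < p" and B: "0 \<le> B"
    and moment: "(\<integral>\<^sup>+\<omega>. ennreal (norm (Y \<omega>) powr p) \<partial>M) \<le> ennreal B"
  shows "prob {\<omega>\<in>space M. c \<le> norm (Y \<omega>)} \<le> B / c powr p"
proof -
  let ?A = "{\<omega>\<in>space M. c \<le> norm (Y \<omega>)}"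
  have [measurable]: "?A \<in> events" by measurable
  have "ennreal (c powr p * prob ?A) = (\<integral>\<^sup>+\<omega>. ennreal (c powr p) * indicator ?A \<omega> \<partial>M)"
    by (simp add: nn_integral_cmult emeasure_eq_measure ennreal_mult)
  also have "\<dots> \<le> (\<integral>\<^sup>+\<omega>. ennreal (norm (Y \<omega>) powr p) \<partial>M)"
    using c p by (intro nn_integral_mono) (auto simp: indicator_def intro!: ennreal_leI powr_mono2)
  also note moment
  finally have "c powr p * prob ?A \<le> B" using B by (simp only: ennreal_le_iff)
  then show ?thesis using c by (simp add: field_simps)
qed

lemma Limsup_ln_less_zero:
  assumes \<epsilon>: "0 < \<epsilon>" and le: "eventually (\<lambda>t. norm (f t) \<le> exp (- \<epsilon> * t)) at_top"
  shows "Limsup at_top (\<lambda>t::real. ereal (1 / t) * extended_ln (norm (f t))) < 0"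
proof -
  have "Limsup at_top (\<lambda>t::real. ereal (1 / t) * extended_ln (norm (f t))) \<le> ereal (- \<epsilon>)"
  proof (rule Limsup_bounded)
    show "eventually (\<lambda>t. ereal (1 / t) * extended_ln (norm (f t)) \<le> ereal (- \<epsilon>)) at_top"
      using le eventually_gt_at_top[of 0]
    proof eventually_elim
      case (elim t)
      show ?case
      proof (cases "norm (f t) = 0")
        \<comment> \<open>Here the product is \<open>- \<infinity>\<close>, since
          \<open>1 / t\<close> is positive.\<close>
        case True
        then show ?thesis using elim by (simp add: extended_ln_def)
      next
        case False
        then have "ln (norm (f t)) \<le> ln (exp (- \<epsilon> * t))"
          using elim by (subst ln_le_cancel_iff) auto
        then have "ln (norm (f t)) / t \<le> - \<epsilon>" using elim by (simp add: divide_le_eq)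
        then show ?thesis using False by (simp add: extended_ln_def)
      qed
    qed
  qed
  also have "\<dots> < 0" using \<epsilon> by simp
  finally show ?thesis .
qed

context regime_switching_jump_diffusion
begin

text \<open>\<open>G\<close> ranges over rational times to be an event; right continuity then
  controls all other times of the interval.\<close>

lemma ottaviani_interval:
  fixes x :: "real^'r" and \<rho> :: real
  assumes large: "\<And>y c u. c \<in> {1..m} \<Longrightarrow> 0 \<le> u \<Longrightarrow> u \<le> \<delta> \<Longrightarrow>
      1 / 2 \<le> prob {\<omega>\<in>space M. norm y / 2 \<le> norm (X y c u \<omega>)}"
    and a: "a \<in> {1..m}" and T: "0 \<le> T0" "T0 \<le> T1" "T1 \<le> T0 + \<delta>"
  defines "G \<equiv> \<Union>t\<in>\<rat> \<inter> {T0..<T1}. {\<omega>\<in>space M. \<rho> < norm (X x a t \<omega>)}"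
  shows "G \<in> events" and "prob G \<le> 2 * prob {\<omega>\<in>space M. \<rho> / 2 \<le> norm (X x a T1 \<omega>)}"
    and "\<And>\<omega> t. \<omega> \<in> space M - G \<Longrightarrow> T0 \<le> t \<Longrightarrow> t < T1 \<Longrightarrow> norm (X x a t \<omega>) \<le> \<rho>"
proof -
  have count: "countable (\<rat> \<inter> {T0..<T1})" by (intro countable_Int1 countable_rat)
  have meas: "{\<omega>\<in>space M. \<rho> < norm (X x a t \<omega>)} \<in> events" if "t \<in> \<rat> \<inter> {T0..<T1}" for t
  proof -
    have [measurable]: "X x a t \<in> borel_measurable M" using X_measurable[OF a, of t] that T by simp
    show ?thesis by measurable
  qed
  show "G \<in> events" unfolding G_def using count meas by (intro sets.countable_UN') auto
  show "prob G \<le> 2 * prob {\<omega>\<in>space M. \<rho> / 2 \<le> norm (X x a T1 \<omega>)}"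
    unfolding G_def
  proof (rule measure_countable_UN_le[OF count meas])
    fix S assume S: "finite S" "S \<subseteq> \<rat> \<inter> {T0..<T1}"
    show "prob (\<Union>t\<in>S. {\<omega>\<in>space M. \<rho> < norm (X x a t \<omega>)})
        \<le> 2 * prob {\<omega>\<in>space M. \<rho> / 2 \<le> norm (X x a T1 \<omega>)}"
      by (rule ottaviani_finite[OF large a S(1)]) (use S(2) T in force)+
  qed
  show "norm (X x a t \<omega>) \<le> \<rho>" if \<omega>: "\<omega> \<in> space M - G" and t: "T0 \<le> t" "t < T1" for \<omega> t
  proof (rule ccontr)
    assume "\<not> norm (X x a t \<omega>) \<le> \<rho>"
    then have "\<rho> < norm (X x a t \<omega>)" by simp
    moreover have "((\<lambda>t. X x a t \<omega>) \<longlongrightarrow> X x a t \<omega>) (at_right t)"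
      using X_cadlag[OF a, of \<omega> x] \<omega> t T by (simp add: cadlag_def)
    ultimately have "eventually (\<lambda>u. \<rho> < norm (X x a u \<omega>)) (at_right t)"
      by (intro order_tendstoD(1)[OF tendsto_norm])
    then obtain c where c: "t < c" "\<And>u. t < u \<Longrightarrow> u < c \<Longrightarrow> \<rho> < norm (X x a u \<omega>)"
      by (auto simp: eventually_at_right_field)
    \<comment> \<open>Exceeding \<open>\<rho>\<close> is an open condition and therefore persists to
      the right of \<open>t\<close>; as \<open>T1\<close> is excluded from the interval, a rational
      time remains between \<open>t\<close> and \<open>T1\<close>.\<close>
    have "t < min c T1" using c t by simp
    then obtain u where "u \<in> \<rat>" "t < u" "u < min c T1" using Rats_dense_in_real by blast
    then have "u \<in> \<rat> \<inter> {T0..<T1}" "\<rho> < norm (X x a u \<omega>)" using c t by auto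
    then show False using \<omega> by (auto simp: G_def)
  qed
qed

lemma eventually_exponentially_small:
  assumes large: "\<And>y c u. c \<in> {1..m} \<Longrightarrow> 0 \<le> u \<Longrightarrow> u \<le> \<delta> \<Longrightarrow>
      1 / 2 \<le> prob {\<omega>\<in>space M. norm y / 2 \<le> norm (X y c u \<omega>)}"
    and \<delta>: "0 < \<delta>" and p: "0 < p" and k: "0 < k" and C: "0 \<le> C" and a: "a \<in> {1..m}"
    and moment: "\<And>t. 0 \<le> t \<Longrightarrow> (\<integral>\<^sup>+\<omega>. ennreal (norm (X x a t \<omega>) powr p) \<partial>M) \<le> ennreal (C * exp (- k * t))"
  shows "AE \<omega> in M. eventually (\<lambda>t. norm (X x a t \<omega>) \<le> exp (- (k / (2 * p)) * t)) at_top"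
proof -
  \<comment> \<open>Since \<open>\<epsilon> * p = k / 2\<close>, Markov's inequality at this
    threshold still leaves the decay rate \<open>k / 2\<close>.\<close>
  define \<epsilon> where "\<epsilon> = k / (2 * p)"
  have \<epsilon>: "0 < \<epsilon>" using k p by (simp add: \<epsilon>_def)
  define T where "T n = real n * \<delta>" for n
  have T: "0 \<le> T n" "T (Suc n) = T n + \<delta>" for n using \<delta> by (simp_all add: T_def algebra_simps)
  \<comment> \<open>Taking the right end point \<open>T (Suc n)\<close> makes
    \<open>\<rho> n\<close> smaller than exp(- \<epsilon> t) throughout the n-th interval.\<close>
  define \<rho> where "\<rho> n = exp (- \<epsilon> * T (Suc n))" for n
  define G where "G n = (\<Union>t\<in>\<rat> \<inter> {T n..<T (Suc n)}. {\<omega>\<in>space M. \<rho> n < norm (X x a t \<omega>)})" for n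
  have G: "G n \<in> events" "prob (G n) \<le> 2 * prob {\<omega>\<in>space M. \<rho> n / 2 \<le> norm (X x a (T (Suc n)) \<omega>)}"
    "\<And>\<omega> t. \<omega> \<in> space M - G n \<Longrightarrow> T n \<le> t \<Longrightarrow> t < T (Suc n) \<Longrightarrow> norm (X x a t \<omega>) \<le> \<rho> n" for n
  proof -
    have "T n \<le> T (Suc n)" "T (Suc n) \<le> T n + \<delta>" using T(2)[of n] \<delta> by simp_all
    note interval = ottaviani_interval[OF large a T(1) this, where \<rho>="\<rho> n" and x=x, folded G_def]
    show "G n \<in> events" "prob (G n) \<le> 2 * prob {\<omega>\<in>space M. \<rho> n / 2 \<le> norm (X x a (T (Suc n)) \<omega>)}"
      by (rule interval; assumption)+
    show "norm (X x a t \<omega>) \<le> \<rho> n" if "\<omega> \<in> space M - G n" "T n \<le> t" "t < T (Suc n)" for \<omega> t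
      by (rule interval(3)[OF _ _ _ that])
  qed
  \<comment> \<open>The outer 2 comes from Ottaviani's inequality, \<open>2 powr p\<close> from the
    halved threshold.\<close>
  define D where "D = 2 * (C * 2 powr p)"
  have pG: "prob (G n) \<le> D * exp (- k / 2 * \<delta>) ^ Suc n" for n
  proof -
    have "prob {\<omega>\<in>space M. \<rho> n / 2 \<le> norm (X x a (T (Suc n)) \<omega>)}
        \<le> C * exp (- k * T (Suc n)) / (\<rho> n / 2) powr p"
      using moment[OF T(1)] p C X_measurable[OF a T(1)]
      by (intro prob_norm_ge_le_moment) (auto simp: \<rho>_def)
    also have "(\<rho> n / 2) powr p = exp (- (k / 2) * T (Suc n)) / 2 powr p"
      using p by (simp add: \<rho>_def \<epsilon>_def powr_divide exp_powr_real)
    also have "C * exp (- k * T (Suc n)) / (exp (- (k / 2) * T (Suc n)) / 2 powr p)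
        = C * 2 powr p * (exp (- k * T (Suc n)) / exp (- (k / 2) * T (Suc n)))" by simp
    also have "exp (- k * T (Suc n)) / exp (- (k / 2) * T (Suc n)) = exp (- (k / 2) * T (Suc n))"
      unfolding exp_diff[symmetric] by (simp add: field_simps)
    also have "\<dots> = exp (- k / 2 * \<delta>) ^ Suc n"
      unfolding exp_of_nat_mult[symmetric] by (simp add: T_def field_simps)
    finally show ?thesis using G(2)[of n] by (simp add: D_def)
  qed
  have "summable (\<lambda>n. exp (- k / 2 * \<delta>) ^ n)"
    using k \<delta> by (intro summable_geometric) simp
  then have "summable (\<lambda>n. (D * exp (- k / 2 * \<delta>)) * exp (- k / 2 * \<delta>) ^ n)"
    by (rule summable_mult)
  then have "summable (\<lambda>n. D * exp (- k / 2 * \<delta>) ^ Suc n)"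
    by (simp only: power_Suc mult.assoc)
  then have sum: "summable (\<lambda>n. prob (G n))"
    by (rule summable_comparison_test'[where N=0])
      (use pG in \<open>simp only: real_norm_def abs_of_nonneg[OF measure_nonneg]\<close>)
  have "AE \<omega> in M. eventually (\<lambda>n. \<omega> \<in> space M - G n) sequentially"
    by (rule borel_cantelli_AE1[OF G(1) _ sum]) (simp add: emeasure_eq_measure)
  then show ?thesis
  proof eventually_elim
    fix \<omega> assume "eventually (\<lambda>n. \<omega> \<in> space M - G n) sequentially"
    then obtain n0 where n0: "\<And>n. n0 \<le> n \<Longrightarrow> \<omega> \<in> space M - G n" by (auto simp: eventually_sequentially)
    have "norm (X x a t \<omega>) \<le> exp (- \<epsilon> * t)" if t: "T n0 \<le> t" for t
    proof -
      \<comment> \<open>The index of the interval of length \<open>\<delta>\<close> that contains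
        \<open>t\<close>.\<close>
      define n where "n = nat \<lfloor>t / \<delta>\<rfloor>"
      have t0: "0 \<le> t / \<delta>" using T(1)[of n0] t \<delta> by simp
      have n: "real n \<le> t / \<delta>" "t / \<delta> < real n + 1" using t0 by (auto simp: n_def floor_less_iff)
      have tn: "T n \<le> t" "t < T (Suc n)" using n \<delta> by (simp_all add: T_def field_simps)
      have "n0 \<le> n" unfolding n_def using t \<delta> by (simp add: le_nat_floor T_def pos_le_divide_eq)
      then have "norm (X x a t \<omega>) \<le> \<rho> n" using G(3) n0 tn by blast
      also have "\<dots> \<le> exp (- \<epsilon> * t)" using tn(2) \<epsilon> by (simp add: \<rho>_def)
      finally show ?thesis .
    qed
    then show "eventually (\<lambda>t. norm (X x a t \<omega>) \<le> exp (- (k / (2 * p)) * t)) at_top"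
      unfolding eventually_at_top_linorder \<epsilon>_def by blast
  qed
qed

end

theorem theorem4p4:
  fixes M :: "'a measure" and F :: "real \<Rightarrow> 'a measure"
    and w :: "real \<Rightarrow> 'a \<Rightarrow> real^'d::finite"
    and \<Gamma> :: "(real^'r::finite) set" and lam :: real and \<pi> :: "(real^'r) measure"
    and N :: "'a \<Rightarrow> (real \<times> (real^'r)) measure"
    and m :: nat
    and b :: "real^'r \<Rightarrow> nat \<Rightarrow> real^'r"
    and \<sigma> :: "real^'r \<Rightarrow> nat \<Rightarrow> real^'d^'r"
    and g :: "real^'r \<Rightarrow> nat \<Rightarrow> real^'r \<Rightarrow> real^'r"
    and q :: "real^'r \<Rightarrow> nat \<Rightarrow> nat \<Rightarrow> real"
    and X :: "real^'r \<Rightarrow> nat \<Rightarrow> real \<Rightarrow> 'a \<Rightarrow> real^'r"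
    and \<alpha> :: "real^'r \<Rightarrow> nat \<Rightarrow> real \<Rightarrow> 'a \<Rightarrow> nat"
    and gstar :: "nat \<Rightarrow> real" and p :: real
  assumes "regime_switching_jump_diffusion M F w \<Gamma> lam \<pi> N m b \<sigma> g q X \<alpha>"
    and A1: "\<forall>i\<in>{1..m}. b 0 i = 0 \<and> \<sigma> 0 i = 0 \<and> (\<forall>\<gamma>\<in>\<Gamma>. g 0 i \<gamma> = 0)"
      "\<forall>i\<in>{1..m}. \<forall>x. \<sigma> x i = 0 \<longrightarrow> x = 0"
    and A2: "\<exists>K\<^sub>0>0. \<forall>x y. \<forall>i\<in>{1..m}.
        norm (b x i - b y i) + norm (\<sigma> x i - \<sigma> y i) \<le> K\<^sub>0 * norm (x - y) \<and>
        (\<forall>\<gamma>\<in>\<Gamma>. norm (g x i \<gamma> - g y i \<gamma>) \<le> K\<^sub>0 * norm (x - y))"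
    and A3: "\<forall>x. \<forall>i\<in>{1..m}. \<forall>\<gamma>\<in>\<Gamma>. norm (g x i \<gamma>) \<le> gstar i * norm x"
    and "p > 0"
    and "exponentially_p_stable M m X p"
  shows "almost_surely_exponentially_stable M m X"
proof -
  interpret regime_switching_jump_diffusion M F w \<Gamma> lam \<pi> N m b \<sigma> g q X \<alpha> by fact
  obtain K0 where K0: "0 < K0" and lip: "\<And>x y i. i \<in> {1..m} \<Longrightarrow>
      norm (b x i - b y i) + norm (\<sigma> x i - \<sigma> y i) \<le> K0 * norm (x - y)"
    using A2 by blast
  \<comment> \<open>The Lipschitz condition compared with the point 0, where both coefficients
    vanish.\<close>
  have growth: "norm (b x i) \<le> K0 * norm x" "norm (\<sigma> x i) \<le> K0 * norm x" if "i \<in> {1..m}" for x i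
  proof -
    have "norm (b x i) + norm (\<sigma> x i) \<le> K0 * norm x" using lip[OF that, of x 0] A1(1) that by simp
    then show "norm (b x i) \<le> K0 * norm x" "norm (\<sigma> x i) \<le> K0 * norm x"
      using norm_ge_zero[of "b x i"] norm_ge_zero[of "\<sigma> x i"] by linarith+
  qed
  \<comment> \<open>\<open>1 / R\<close> serves as the time step: each summand takes care of one
    smallness condition of \<open>stays_large\<close>, and 18432 is 4 * 4608.\<close>
  define R where "R = 6 * K0 + 4 * lam + 18432 * real CARD('d) * K0\<^sup>2"
  have R: "0 < R" using K0 lam_pos unfolding R_def by (intro add_pos_nonneg add_pos_pos) auto
  have "6 * K0 \<le> R" "4 * lam \<le> R" "18432 * real CARD('d) * K0\<^sup>2 \<le> R"
    using K0 lam_pos by (simp_all add: R_def)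
  then have "0 < 1 / R" "6 * K0 * (1 / R) \<le> 1" "lam * (1 / R) \<le> 1 / 4"
    "4608 * real CARD('d) * K0\<^sup>2 * (1 / R) \<le> 1 / 4"
    using R by (simp_all add: divide_le_eq)
  then have large: "1 / 2 \<le> prob {\<omega>\<in>space M. norm y / 2 \<le> norm (X y c u \<omega>)}"
    if "c \<in> {1..m}" "0 \<le> u" "u \<le> 1 / R" for y c u
    by (intro stays_large[OF K0 growth _ _ _ _ that])
  obtain K k where Kk: "0 < K" "0 < k" and moment: "\<And>t x a. 0 \<le> t \<Longrightarrow> a \<in> {1..m} \<Longrightarrow>
      (\<integral>\<^sup>+\<omega>. ennreal (norm (X x a t \<omega>) powr p) \<partial>M) \<le> ennreal (K * norm x powr p * exp (- k * t))"
    using \<open>exponentially_p_stable M m X p\<close> unfolding exponentially_p_stable_def by blast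
  show ?thesis unfolding almost_surely_exponentially_stable_def
  proof (intro allI ballI)
    fix x a assume a: "a \<in> {1..m}"
    have "AE \<omega> in M. eventually (\<lambda>t. norm (X x a t \<omega>) \<le> exp (- (k / (2 * p)) * t)) at_top"
    proof (rule eventually_exponentially_small[where \<delta>="1 / R" and C="K * norm x powr p"])
      show "1 / 2 \<le> prob {\<omega>\<in>space M. norm y / 2 \<le> norm (X y c u \<omega>)}"
        if "c \<in> {1..m}" "0 \<le> u" "u \<le> 1 / R" for y c u
        using large that .
    qed (use R Kk \<open>p > 0\<close> a moment[OF _ a] in simp_all)
    then show "AE \<omega> in M. Limsup at_top (\<lambda>t. ereal (1 / t) * extended_ln (norm (X x a t \<omega>))) < 0"
    proof eventually_elim
      case (elim \<omega>)
      show ?case using Limsup_ln_less_zero[OF _ elim] Kk \<open>p > 0\<close> by simp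
    qed
  qed
qed

end
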